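(* Let $(X,d)$ be a compact metric space and $f:X\to X$ a continuous map with the specification property. Assume that $\varphi\in C(X)$ satisfies $\inf_{\mu\in\mathcal{M}_f(X)}\int\varphi\,d\mu<\sup_{\mu\in\mathcal{M}_f(X)}\int\varphi\,d\mu$. Let $$\widehat X_\varphi=\left\{x\in X:\lim_{n\to\infty}\frac1n\sum_{i=0}^{n-1}\varphi(f^i(x))\text{ does not exist}\right\}.$$ Then $P_{\widehat X_\varphi}(\psi)=P_X^{classic}(\psi)$ for all $\psi\in C(X)$.
   Context: $C(X)$ is the space of continuous functions $X\to\mathbb{R}$; $\mathcal{M}_f(X)$ is the set of $f$-invariant Borel probability measures on $X$. Specification property: a continuous map $f:X\to X$ has the specification property if for all $\epsilon>0$ there is an integer $m=m(\epsilon)$ such that for any finite collection of finite integer intervals $I_j=[a_j,b_j]\subset\mathbb{N}$, $j=1,\dots,k$, with $a_{j+1}-b_j\ge m(\epsilon)$ for $j=1,\dots,k-1$, and any $x_1,\dots,x_k\in X$, there is a point $x\in X$ with $d(f^{p+a_j}x,f^px_j)<\epsilon$ for all $p=0,\dots,b_j-a_j$ and every $j=1,\dots,k$. Topological pressure of a (not necessarily compact or invariant) Borel set $Z\subset X$: let $B_n(x,\epsilon)=\{y\in X:d(f^i(x),f^i(y))<\epsilon\text{ for all }i=0,\dots,n-1\}$. For $\psi\in C(X)$, $\alpha\in\mathbb{R}$ and a finite or countable collection $\Gamma=\{B_{n_i}(x_i,\epsilon)\}_i$ put $$Q(Z,\alpha,\Gamma,\psi)=\sum_{B_{n_i}(x_i,\epsilon)\in\Gamma}\exp\Big(-\alpha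 n_i+\sup_{x\in B_{n_i}(x_i,\epsilon)}\sum_{k=0}^{n_i-1}\psi(f^k(x))\Big).$$ Let $M(Z,\alpha,\epsilon,N,\psi)=\inf_\Gamma Q(Z,\alpha,\Gamma,\psi)$, the infimum being over all finite or countable such collections $\Gamma$ with $x_i\in X$ that cover $Z$ and have $n_i\ge N$ for all $i$. Let $m(Z,\alpha,\epsilon,\psi)=\lim_{N\to\infty}M(Z,\alpha,\epsilon,N,\psi)$, $P_Z(\psi,\epsilon)=\inf\{\alpha:m(Z,\alpha,\epsilon,\psi)=0\}=\sup\{\alpha:m(Z,\alpha,\epsilon,\psi)=\infty\}$, and $P_Z(\psi)=\lim_{\epsilon\to0}P_Z(\psi,\epsilon)$. $P_X^{classic}(\psi)$ denotes the usual topological pressure of $\psi$ for the continuous map $f$ on the compact space $X$ (it agrees with $P_X(\psi)$). *)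

theory Defs
  imports "HOL-Probability.Probability"
begin

text \<open>The compact metric space \<open>X\<close> is the universe of a type of class \<open>metric_space\<close>;
  compactness of \<open>UNIV\<close> is assumed where it is needed.\<close>

definition birkhoff_sum :: "('a \<Rightarrow> 'a) \<Rightarrow> ('a \<Rightarrow> real) \<Rightarrow> nat \<Rightarrow> 'a \<Rightarrow> real" where
  "birkhoff_sum f \<psi> n x = (\<Sum>i<n. \<psi> ((f ^^ i) x))"

definition invariant_measures :: "('a::metric_space \<Rightarrow> 'a) \<Rightarrow> 'a measure set" where
  "invariant_measures f = {\<mu>. prob_space \<mu> \<and> sets \<mu> = sets borel \<and> distr \<mu> borel f = \<mu>}"

definition specification_property :: "('a::metric_space \<Rightarrow> 'a) \<Rightarrow> bool" where
  "specification_property f \<longleftrightarrow>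
    (\<forall>\<epsilon>>0. \<exists>m::int. \<forall>(k::nat) (a::nat \<Rightarrow> nat) (b::nat \<Rightarrow> nat) (xs::nat \<Rightarrow> 'a).
      (\<forall>j\<in>{1..k}. a j \<le> b j) \<longrightarrow>
      (\<forall>j\<in>{1..<k}. int (a (j + 1)) - int (b j) \<ge> m) \<longrightarrow>
      (\<exists>x. \<forall>j\<in>{1..k}. \<forall>p\<le>b j - a j. dist ((f ^^ (p + a j)) x) ((f ^^ p) (xs j)) < \<epsilon>))"

definition bowen_ball :: "('a::metric_space \<Rightarrow> 'a) \<Rightarrow> nat \<Rightarrow> 'a \<Rightarrow> real \<Rightarrow> 'a set" where
  "bowen_ball f n x \<epsilon> = {y. \<forall>i<n. dist ((f ^^ i) x) ((f ^^ i) y) < \<epsilon>}"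

text \<open>A collection of Bowen balls is given by its set \<open>\<Gamma>\<close> of labels \<open>(x, n)\<close>, since a set may be
  a Bowen ball for several \<open>n\<close> and the weight depends on \<open>n\<close>. Repeated labels in an indexed
  family only increase the sum, so using sets of labels does not affect the infimum below.
  For \<open>\<epsilon> > 0\<close> and \<open>\<psi>\<close> continuous on a compact space the real supremum is taken over a
  nonempty bounded set.\<close>

definition pressure_Q ::
  "('a::metric_space \<Rightarrow> 'a) \<Rightarrow> real \<Rightarrow> real \<Rightarrow> ('a \<times> nat) set \<Rightarrow> ('a \<Rightarrow> real) \<Rightarrow> ennreal" where
  "pressure_Q f \<alpha> \<epsilon> \<Gamma> \<psi> =
    (\<Sum>\<^sub>\<infinity>(x, n)\<in>\<Gamma>. ennreal (exp (- \<alpha> * real n + (SUP y\<in>bowen_ball f n x \<epsilon>. birkhoff_sum f \<psi> n y))))"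

definition pressure_covers ::
  "('a::metric_space \<Rightarrow> 'a) \<Rightarrow> 'a set \<Rightarrow> real \<Rightarrow> nat \<Rightarrow> ('a \<times> nat) set set" where
  "pressure_covers f Z \<epsilon> N =
    {\<Gamma>. countable \<Gamma> \<and> Z \<subseteq> (\<Union>(x, n)\<in>\<Gamma>. bowen_ball f n x \<epsilon>) \<and> (\<forall>(x, n)\<in>\<Gamma>. n \<ge> N)}"

definition pressure_M ::
  "('a::metric_space \<Rightarrow> 'a) \<Rightarrow> 'a set \<Rightarrow> real \<Rightarrow> real \<Rightarrow> nat \<Rightarrow> ('a \<Rightarrow> real) \<Rightarrow> ennreal" where
  "pressure_M f Z \<alpha> \<epsilon> N \<psi> = (INF \<Gamma>\<in>pressure_covers f Z \<epsilon> N. pressure_Q f \<alpha> \<epsilon> \<Gamma> \<psi>)"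

text \<open>The limit exists because \<open>pressure_M\<close> is nondecreasing in \<open>N\<close>.\<close>

definition pressure_m ::
  "('a::metric_space \<Rightarrow> 'a) \<Rightarrow> 'a set \<Rightarrow> real \<Rightarrow> real \<Rightarrow> ('a \<Rightarrow> real) \<Rightarrow> ennreal" where
  "pressure_m f Z \<alpha> \<epsilon> \<psi> = lim (\<lambda>N. pressure_M f Z \<alpha> \<epsilon> N \<psi>)"

text \<open>Extended real values are needed: the pressure of the empty set is \<open>-\<infinity>\<close>.\<close>

definition pressure_at_scale ::
  "('a::metric_space \<Rightarrow> 'a) \<Rightarrow> 'a set \<Rightarrow> ('a \<Rightarrow> real) \<Rightarrow> real \<Rightarrow> ereal" where
  "pressure_at_scale f Z \<psi> \<epsilon> = (INF \<alpha>\<in>{\<alpha>. pressure_m f Z \<alpha> \<epsilon> \<psi> = 0}. ereal \<alpha>)"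

text \<open>Over a compact space with \<open>\<psi>\<close> continuous the limit exists in the extended reals, although
  \<open>pressure_at_scale\<close> need not be monotone in \<open>\<epsilon>\<close>: for \<open>\<delta> < \<epsilon>\<close> its value at \<open>\<epsilon>\<close> exceeds its
  value at \<open>\<delta>\<close> by at most \<open>sup {\<bar>\<psi> x - \<psi> y\<bar> | dist x y < 2 \<epsilon>}\<close>.\<close>

definition pressure ::
  "('a::metric_space \<Rightarrow> 'a) \<Rightarrow> 'a set \<Rightarrow> ('a \<Rightarrow> real) \<Rightarrow> ereal" where
  "pressure f Z \<psi> = Lim (at_right 0) (\<lambda>\<epsilon>. pressure_at_scale f Z \<psi> \<epsilon>)"

text \<open>The classical pressure is defined through \<open>(n, \<epsilon>)\<close>-separated sets. On a compact space with
  \<open>f\<close> continuous, the cardinalities of such sets are bounded for fixed \<open>n\<close> and \<open>\<epsilon> > 0\<close>. So finiteness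
  is no restriction, the real supremum is finite, and it is positive because of singletons.
  The limit exists by monotonicity in \<open>\<epsilon>\<close>.\<close>

definition separated_set :: "('a::metric_space \<Rightarrow> 'a) \<Rightarrow> nat \<Rightarrow> real \<Rightarrow> 'a set \<Rightarrow> bool" where
  "separated_set f n \<epsilon> E \<longleftrightarrow>
    (\<forall>x\<in>E. \<forall>y\<in>E. x \<noteq> y \<longrightarrow> (\<exists>i<n. dist ((f ^^ i) x) ((f ^^ i) y) > \<epsilon>))"

definition classic_partition ::
  "('a::metric_space \<Rightarrow> 'a) \<Rightarrow> ('a \<Rightarrow> real) \<Rightarrow> nat \<Rightarrow> real \<Rightarrow> real" where
  "classic_partition f \<psi> n \<epsilon> =
    (SUP E\<in>{E. finite E \<and> separated_set f n \<epsilon> E}. \<Sum>x\<in>E. exp (birkhoff_sum f \<psi> n x))"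

definition classic_pressure :: "('a::metric_space \<Rightarrow> 'a) \<Rightarrow> ('a \<Rightarrow> real) \<Rightarrow> ereal" where
  "classic_pressure f \<psi> =
    Lim (at_right 0) (\<lambda>\<epsilon>. limsup (\<lambda>n. ereal (ln (classic_partition f \<psi> n \<epsilon>) / real n)))"

definition irregular_set :: "('a \<Rightarrow> 'a) \<Rightarrow> ('a \<Rightarrow> real) \<Rightarrow> 'a set" where
  "irregular_set f \<phi> = {x. \<not> convergent (\<lambda>n. (1 / real n) * (\<Sum>i<n. \<phi> ((f ^^ i) x)))}"

end

theory Submission
  imports Defs
begin

text \<open>For the upper bound, a maximal \<open>(n, \<epsilon>/2)\<close>-separated set yields a cover by Bowen balls.

  For the lower bound no measure of large free energy is needed. Fix \<open>R\<close> below the classical pressure,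
  a small \<open>\<epsilon>\<close> and one large \<open>n\<close>. By the pigeonhole principle, some \<open>(n, 4\<epsilon>)\<close>-separated set \<open>S\<close> of large weight
  has all Birkhoff averages of \<open>\<phi>\<close> close to one number \<open>c\<close>, and by invariance of two measures with different
  integrals some orbit segment, started at \<open>y\<close>, has its average at a definite distance from \<open>c\<close>. Specification
  glues blocks chosen freely from \<open>S\<close>, except at the positions in a set \<open>F\<close> of small but oscillating density,
  where the block \<open>y\<close> is forced. The oscillation makes every glued orbit irregular, while the small density
  hardly lowers the pressure. The glued points form a compact set, so a cover by Bowen balls may be taken
  finite, and weighting words by the product of their normalised block weights bounds its sum from below.

  The hypothesis on \<open>\<phi>\<close> compares an infimum and a supremum in the reals, which say nothing when there is
  no invariant measure, so the existence of one (Krylov--Bogoliubov) has to be proved. Coding the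
  space into the reals reduces it to Helly's selection theorem.\<close>

section \<open>Bowen balls, separated sets and the upper bound\<close>

lemma compact_continuous_bound:
  fixes g :: "'a::metric_space \<Rightarrow> real"
  assumes "compact (UNIV :: 'a set)" "continuous_on UNIV g"
  obtains B where "B > 0" "\<And>x. \<bar>g x\<bar> \<le> B"
proof -
  have "bounded (range g)" using compact_imp_bounded[OF compact_continuous_image[OF assms(2,1)]] .
  then obtain B where "B > 0" "\<forall>y\<in>range g. norm y \<le> B" unfolding bounded_pos by blast
  then show thesis using that by auto
qed

lemma compact_continuous_modulus:
  fixes g :: "'a::metric_space \<Rightarrow> real"
  assumes "compact (UNIV :: 'a set)" "continuous_on UNIV g" "w > 0"
  obtains \<delta> where "\<delta> > 0" "\<And>x y. dist x y < \<delta> \<Longrightarrow> \<bar>g x - g y\<bar> \<le> w"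
proof -
  have "uniformly_continuous_on UNIV g" by (rule compact_uniformly_continuous[OF assms(2,1)])
  then obtain \<delta> where "\<delta> > 0" "\<And>x y. dist x y < \<delta> \<Longrightarrow> dist (g x) (g y) < w"
    using assms(3) unfolding uniformly_continuous_on_def by (metis UNIV_I)
  then show thesis using that by (auto simp: dist_real_def less_imp_le)
qed

lemma continuous_on_funpow:
  fixes f :: "'a::topological_space \<Rightarrow> 'a"
  assumes "continuous_on UNIV f"
  shows "continuous_on UNIV (f ^^ n)"
proof (induction n)
  case (Suc n)
  then show ?case
    using continuous_on_compose[OF Suc, of f] continuous_on_subset[OF assms] by simp
qed simp

lemma birkhoff_sum_abs_le:
  assumes "\<And>x. \<bar>\<psi> x\<bar> \<le> B"
  shows "\<bar>birkhoff_sum f \<psi> n x\<bar> \<le> real n * B"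
proof -
  have "\<bar>birkhoff_sum f \<psi> n x\<bar> \<le> (\<Sum>i<n. \<bar>\<psi> ((f ^^ i) x)\<bar>)"
    unfolding birkhoff_sum_def by (rule sum_abs)
  also have "\<dots> \<le> (\<Sum>i<n. B)" by (intro sum_mono assms)
  finally show ?thesis by simp
qed

lemma birkhoff_sum_add:
  "birkhoff_sum f \<psi> (m + n) x = birkhoff_sum f \<psi> m x + birkhoff_sum f \<psi> n ((f ^^ m) x)"
proof (induction n)
  case (Suc n)
  then show ?case
    by (simp add: birkhoff_sum_def funpow_add[of n m, symmetric, THEN fun_cong, unfolded o_def] add.commute)
qed (simp add: birkhoff_sum_def)

lemma birkhoff_sum_diff_le:
  assumes "\<And>i. i < n \<Longrightarrow> \<bar>\<psi> ((f ^^ i) x) - \<psi> ((f ^^ i) y)\<bar> \<le> w"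
  shows "\<bar>birkhoff_sum f \<psi> n x - birkhoff_sum f \<psi> n y\<bar> \<le> real n * w"
proof -
  have "\<bar>birkhoff_sum f \<psi> n x - birkhoff_sum f \<psi> n y\<bar> \<le> (\<Sum>i<n. \<bar>\<psi> ((f ^^ i) x) - \<psi> ((f ^^ i) y)\<bar>)"
    unfolding birkhoff_sum_def sum_subtractf[symmetric] by (rule sum_abs)
  also have "\<dots> \<le> (\<Sum>i<n. w)" by (intro sum_mono assms) auto
  finally show ?thesis by simp
qed

lemma open_bowen_ball:
  assumes "continuous_on UNIV f"
  shows "open (bowen_ball f n x \<epsilon>)"
proof -
  have "bowen_ball f n x \<epsilon> = (\<Inter>i\<in>{..<n}. {y. dist ((f ^^ i) x) ((f ^^ i) y) < \<epsilon>})"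
    unfolding bowen_ball_def by auto
  moreover have "open {y. dist ((f ^^ i) x) ((f ^^ i) y) < \<epsilon>}" for i
    by (intro open_Collect_less continuous_intros continuous_on_funpow assms)
  ultimately show ?thesis by auto
qed

lemma centre_in_bowen_ball: "\<epsilon> > 0 \<Longrightarrow> x \<in> bowen_ball f n x \<epsilon>"
  by (simp add: bowen_ball_def)

text \<open>Finitely many Bowen balls of radius \<epsilon>/2 cover the compact space, and by the
  triangle inequality each contains at most one point of a separated set. The size of one such cover
  therefore bounds all separated sets at once.\<close>

lemma separated_set_card_bound:
  fixes f :: "'a::metric_space \<Rightarrow> 'a"
  assumes comp: "compact (UNIV :: 'a set)" and cont: "continuous_on UNIV f" and "\<epsilon> > 0"
  obtains C where "\<And>E. separated_set f n \<epsilon> E \<Longrightarrow> finite E \<and> card E \<le> C"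
proof -
  have cov: "(UNIV :: 'a set) \<subseteq> (\<Union>x\<in>UNIV. bowen_ball f n x (\<epsilon> / 2))"
    using centre_in_bowen_ball[of "\<epsilon> / 2"] \<open>\<epsilon> > 0\<close> by auto
  obtain F where F: "finite F" "(UNIV :: 'a set) \<subseteq> (\<Union>x\<in>F. bowen_ball f n x (\<epsilon> / 2))"
    by (rule compactE_image[OF comp open_bowen_ball[OF cont] cov])
  have "\<exists>x\<in>F. y \<in> bowen_ball f n x (\<epsilon> / 2)" for y using F(2) by blast
  then obtain g where g: "\<And>y. g y \<in> F" "\<And>y. y \<in> bowen_ball f n (g y) (\<epsilon> / 2)" by metis
  show thesis
  proof
    fix E assume E: "separated_set f n \<epsilon> E"
    have inj: "inj_on g E"
    proof (rule inj_onI, rule ccontr)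
      fix x y assume xy: "x \<in> E" "y \<in> E" "g x = g y" "x \<noteq> y"
      then obtain i where i: "i < n" "dist ((f ^^ i) x) ((f ^^ i) y) > \<epsilon>"
        using E unfolding separated_set_def by blast
      have "dist ((f ^^ i) (g x)) ((f ^^ i) x) < \<epsilon> / 2" "dist ((f ^^ i) (g x)) ((f ^^ i) y) < \<epsilon> / 2"
        using g(2)[of x] g(2)[of y] i(1) xy(3) unfolding bowen_ball_def by auto
      then show False using i(2) dist_triangle3[of "(f ^^ i) x" "(f ^^ i) y" "(f ^^ i) (g x)"] by linarith
    qed
    have sub: "g ` E \<subseteq> F" using g(1) by auto
    show "finite E \<and> card E \<le> card F"
      using inj_on_finite[OF inj sub F(1)] card_inj_on_le[OF inj sub F(1)] by simp
  qed
qed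

section \<open>Classical pressure as a supremum over scales\<close>

definition classic_rate :: "('a::metric_space \<Rightarrow> 'a) \<Rightarrow> ('a \<Rightarrow> real) \<Rightarrow> real \<Rightarrow> ereal" where
  "classic_rate f \<psi> \<epsilon> = limsup (\<lambda>n. ereal (ln (classic_partition f \<psi> n \<epsilon>) / real n))"

context
  fixes f :: "'a::metric_space \<Rightarrow> 'a" and \<psi> :: "'a \<Rightarrow> real"
  assumes comp: "compact (UNIV :: 'a set)" and cont: "continuous_on UNIV f" and cont_\<psi>: "continuous_on UNIV \<psi>"
begin

lemma classic_partition_bdd_above:
  assumes "\<epsilon> > 0"
  shows "bdd_above ((\<lambda>E. \<Sum>x\<in>E. exp (birkhoff_sum f \<psi> n x)) ` {E. finite E \<and> separated_set f n \<epsilon> E})"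
proof -
  obtain B where B: "B > 0" "\<And>x. \<bar>\<psi> x\<bar> \<le> B" using compact_continuous_bound[OF comp cont_\<psi>] by blast
  obtain C where C: "\<And>E. separated_set f n \<epsilon> E \<Longrightarrow> finite E \<and> card E \<le> C"
    using separated_set_card_bound[OF comp cont assms] by blast
  show ?thesis
  proof (rule bdd_aboveI2)
    fix E assume "E \<in> {E. finite E \<and> separated_set f n \<epsilon> E}"
    then have E: "card E \<le> C" using C by auto
    have "(\<Sum>x\<in>E. exp (birkhoff_sum f \<psi> n x)) \<le> (\<Sum>x\<in>E. exp (real n * B))"
      using birkhoff_sum_abs_le[of \<psi> B f n, OF B(2)] by (intro sum_mono) (auto simp: abs_le_iff)
    also have "\<dots> \<le> real C * exp (real n * B)" using E by simp
    finally show "(\<Sum>x\<in>E. exp (birkhoff_sum f \<psi> n x)) \<le> real C * exp (real n * B)" .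
  qed
qed

lemma sum_le_classic_partition:
  assumes "\<epsilon> > 0" "finite E" "separated_set f n \<epsilon> E"
  shows "(\<Sum>x\<in>E. exp (birkhoff_sum f \<psi> n x)) \<le> classic_partition f \<psi> n \<epsilon>"
  unfolding classic_partition_def
  by (rule cSUP_upper[OF _ classic_partition_bdd_above]) (use assms in auto)

lemma less_classic_partitionD:
  assumes "\<epsilon> > 0" "v < classic_partition f \<psi> n \<epsilon>"
  obtains E where "finite E" "separated_set f n \<epsilon> E" "v < (\<Sum>x\<in>E. exp (birkhoff_sum f \<psi> n x))"
proof -
  have "separated_set f n \<epsilon> {}" by (simp add: separated_set_def)
  then have "{E. finite E \<and> separated_set f n \<epsilon> E} \<noteq> {}" by blast
  then show thesis
    using assms(2) less_cSUP_iff[OF _ classic_partition_bdd_above[OF assms(1)]] that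
    unfolding classic_partition_def by auto
qed

lemma classic_partition_pos:
  assumes "\<epsilon> > 0"
  shows "classic_partition f \<psi> n \<epsilon> > 0"
proof -
  \<comment> \<open>A singleton is vacuously separated; \<open>undefined\<close> merely names some
    point of the space.\<close>
  have "exp (birkhoff_sum f \<psi> n undefined) \<le> classic_partition f \<psi> n \<epsilon>"
    using sum_le_classic_partition[OF assms, of "{undefined}"] by (simp add: separated_set_def)
  then show ?thesis using exp_gt_zero less_le_trans by blast
qed

lemma classic_partition_antimono:
  assumes "0 < \<epsilon>" "\<epsilon> \<le> \<epsilon>'"
  shows "classic_partition f \<psi> n \<epsilon>' \<le> classic_partition f \<psi> n \<epsilon>"
  unfolding classic_partition_def
proof (rule cSUP_subset_mono)
  have "separated_set f n \<epsilon>' {}" by (simp add: separated_set_def)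
  then show "{E. finite E \<and> separated_set f n \<epsilon>' E} \<noteq> {}" by blast
  show "{E. finite E \<and> separated_set f n \<epsilon>' E} \<subseteq> {E. finite E \<and> separated_set f n \<epsilon> E}"
    using assms(2) unfolding separated_set_def by (auto, meson le_less_trans)
qed (use classic_partition_bdd_above[OF assms(1)] in auto)

lemma classic_rate_antimono:
  assumes "0 < \<epsilon>" "\<epsilon> \<le> \<epsilon>'"
  shows "classic_rate f \<psi> \<epsilon>' \<le> classic_rate f \<psi> \<epsilon>"
  unfolding classic_rate_def
proof (rule Limsup_mono, rule always_eventually, rule allI)
  fix n
  have "ln (classic_partition f \<psi> n \<epsilon>') \<le> ln (classic_partition f \<psi> n \<epsilon>)"
    using classic_partition_antimono[OF assms] classic_partition_pos assms by (subst ln_le_cancel_iff) auto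
  then show "ereal (ln (classic_partition f \<psi> n \<epsilon>') / real n) \<le> ereal (ln (classic_partition f \<psi> n \<epsilon>) / real n)"
    by (simp add: divide_right_mono)
qed

text \<open>Shrinking \<epsilon> admits more separated sets, so the rate increases as \<epsilon>
  decreases to 0 and its limit is the supremum. The upper bound uses this at every scale, the lower
  bound at one well chosen scale.\<close>

lemma classic_pressure_eq_SUP: "classic_pressure f \<psi> = (SUP \<epsilon>\<in>{0<..}. classic_rate f \<psi> \<epsilon>)"
proof -
  have "(classic_rate f \<psi> \<longlongrightarrow> (SUP \<epsilon>\<in>{0<..}. classic_rate f \<psi> \<epsilon>)) (at_right 0)"
  proof (rule order_tendstoI)
    fix a assume "a < (SUP \<epsilon>\<in>{0<..}. classic_rate f \<psi> \<epsilon>)"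
    then obtain \<epsilon>0 where \<epsilon>0: "\<epsilon>0 > 0" "a < classic_rate f \<psi> \<epsilon>0" by (auto simp: less_SUP_iff)
    have "a < classic_rate f \<psi> \<epsilon>" if "0 < \<epsilon>" "\<epsilon> < \<epsilon>0" for \<epsilon>
      using classic_rate_antimono[of \<epsilon> \<epsilon>0] that \<epsilon>0(2) by (auto intro: less_le_trans)
    then show "eventually (\<lambda>\<epsilon>. a < classic_rate f \<psi> \<epsilon>) (at_right 0)"
      using \<epsilon>0(1) by (auto simp: eventually_at_right_field)
  next
    fix a assume "(SUP \<epsilon>\<in>{0<..}. classic_rate f \<psi> \<epsilon>) < a"
    then have "classic_rate f \<psi> \<epsilon> < a" if "\<epsilon> > 0" for \<epsilon>
      using that by (meson SUP_upper greaterThan_iff le_less_trans)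
    then show "eventually (\<lambda>\<epsilon>. classic_rate f \<psi> \<epsilon> < a) (at_right 0)"
      by (auto simp: eventually_at_right_field intro: exI[of _ 1])
  qed
  then show ?thesis
    unfolding classic_pressure_def classic_rate_def[symmetric]
    by (intro tendsto_Lim) auto
qed

section \<open>Upper bound through maximal separated sets\<close>

lemma ex_separated_spanning:
  assumes "\<epsilon> > 0"
  obtains E where "finite E" "separated_set f n \<epsilon> E" "\<And>y. \<exists>x\<in>E. \<forall>i<n. dist ((f ^^ i) x) ((f ^^ i) y) \<le> \<epsilon>"
proof -
  obtain C where C: "\<And>E. separated_set f n \<epsilon> E \<Longrightarrow> finite E \<and> card E \<le> C"
    using separated_set_card_bound[OF comp cont assms] by blast
  have "separated_set f n \<epsilon> {}" by (simp add: separated_set_def)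
  \<comment> \<open>Cardinalities are bounded by \<open>C\<close>, so a separated set of greatest
    cardinality exists. A point far from all its members could be added to it, which is impossible;
    hence it spans.\<close>
  then obtain E where E: "separated_set f n \<epsilon> E" "\<And>E'. separated_set f n \<epsilon> E' \<Longrightarrow> card E' \<le> card E"
    using ex_has_greatest_nat[of "separated_set f n \<epsilon>" "{}" card "Suc C"] C by (auto simp: less_Suc_eq_le)
  show thesis
  proof
    show "finite E" "separated_set f n \<epsilon> E" using E(1) C by auto
    fix y
    show "\<exists>x\<in>E. \<forall>i<n. dist ((f ^^ i) x) ((f ^^ i) y) \<le> \<epsilon>"
    proof (cases "y \<in> E")
      case True
      then show ?thesis using assms by (intro bexI[of _ y]) auto
    next
      case False
      show ?thesis
      proof (rule ccontr)
        assume "\<not> ?thesis"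
        then have far: "\<exists>i<n. dist ((f ^^ i) x) ((f ^^ i) y) > \<epsilon>" if "x \<in> E" for x
          using that by (meson not_le)
        then have "separated_set f n \<epsilon> (insert y E)"
          using E(1) unfolding separated_set_def by (auto simp: dist_commute)
        then have "card (insert y E) \<le> card E" by (rule E(2))
        then show False using False \<open>finite E\<close> by simp
      qed
    qed
  qed
qed

text \<open>The cover consists of balls of one common length \<open>n\<close>, centred at a maximal
  (n, \<epsilon>/2)-separated set. It covers the whole space, so \<open>Z\<close> is arbitrary.
  Replacing the supremum over a ball by the value at its centre costs at most \<open>w\<close> per
  time step.\<close>

lemma pressure_at_scale_le_classic_rate:
  assumes "\<epsilon> > 0" and w: "\<And>x y. dist x y < \<epsilon> \<Longrightarrow> \<bar>\<psi> x - \<psi> y\<bar> \<le> w"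
  shows "pressure_at_scale f Z \<psi> \<epsilon> \<le> classic_rate f \<psi> (\<epsilon> / 2) + ereal w"
proof (rule dense_ge)
  fix a assume a: "classic_rate f \<psi> (\<epsilon> / 2) + ereal w < a"
  have "pressure_at_scale f Z \<psi> \<epsilon> \<le> ereal \<alpha>" if \<alpha>: "classic_rate f \<psi> (\<epsilon> / 2) + ereal w < ereal \<alpha>" for \<alpha>
  proof -
    have "classic_rate f \<psi> (\<epsilon> / 2) < ereal (\<alpha> - w)"
      using \<alpha> by (cases "classic_rate f \<psi> (\<epsilon> / 2)") auto
    \<comment> \<open>The room between \<beta> + \<open>w\<close> and \<alpha> makes the sums over
      these covers decay exponentially in \<open>n\<close>.\<close>
    then obtain \<beta> where \<beta>: "classic_rate f \<psi> (\<epsilon> / 2) < ereal \<beta>" "\<beta> < \<alpha> - w"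
      using ereal_dense2[of "classic_rate f \<psi> (\<epsilon> / 2)" "ereal (\<alpha> - w)"] by auto
    then have "\<forall>\<^sub>F n in sequentially. ereal (ln (classic_partition f \<psi> n (\<epsilon> / 2)) / real n) < ereal \<beta>"
      unfolding classic_rate_def by (intro Limsup_lessD)
    then obtain N0 where N0: "\<And>n. n \<ge> N0 \<Longrightarrow> ln (classic_partition f \<psi> n (\<epsilon> / 2)) / real n < \<beta>"
      by (auto simp: eventually_sequentially)
    \<comment> \<open>The bound does not involve \<open>N\<close>: for each fixed \<open>N\<close>
      the length \<open>n\<close> may tend to infinity, which forces \<open>pressure_M\<close> to
      vanish.\<close>
    have M_le: "pressure_M f Z \<alpha> \<epsilon> N \<psi> \<le> ennreal (exp (real n * (\<beta> + w - \<alpha>)))" if n: "n \<ge> Suc N0" "n \<ge> N" for n N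
    proof -
      have "ln (classic_partition f \<psi> n (\<epsilon> / 2)) < real n * \<beta>"
        using N0[of n] n by (simp add: divide_less_eq mult.commute split: if_splits)
      then have Z: "classic_partition f \<psi> n (\<epsilon> / 2) \<le> exp (real n * \<beta>)"
        using classic_partition_pos[of "\<epsilon> / 2" n] \<open>\<epsilon> > 0\<close> by (metis exp_ln exp_less_mono half_gt_zero less_imp_le)
      obtain E where E: "finite E" "separated_set f n (\<epsilon> / 2) E"
        "\<And>y. \<exists>x\<in>E. \<forall>i<n. dist ((f ^^ i) x) ((f ^^ i) y) \<le> \<epsilon> / 2"
        using ex_separated_spanning[of "\<epsilon> / 2" n] \<open>\<epsilon> > 0\<close> by auto
      have cov: "E \<times> {n} \<in> pressure_covers f Z \<epsilon> N"
      proof -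
        have "\<exists>x\<in>E. y \<in> bowen_ball f n x \<epsilon>" for y
        proof -
          obtain x where x: "x \<in> E" "\<forall>i<n. dist ((f ^^ i) x) ((f ^^ i) y) \<le> \<epsilon> / 2" using E(3) by blast
          \<comment> \<open>Halving the scale turns the non-strict estimate for spanning sets into
            the strict one required by Bowen balls.\<close>
          have "\<epsilon> / 2 < \<epsilon>" using \<open>\<epsilon> > 0\<close> by simp
          then have "y \<in> bowen_ball f n x \<epsilon>"
            using x(2) unfolding bowen_ball_def by (auto intro: le_less_trans)
          then show ?thesis using x(1) by blast
        qed
        then show ?thesis using E(1) n unfolding pressure_covers_def by (auto intro: countable_finite)
      qed
      have sup: "(SUP y\<in>bowen_ball f n x \<epsilon>. birkhoff_sum f \<psi> n y) \<le> birkhoff_sum f \<psi> n x + real n * w" for x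
      proof (rule cSUP_least)
        show "bowen_ball f n x \<epsilon> \<noteq> {}" using centre_in_bowen_ball[OF \<open>\<epsilon> > 0\<close>] by blast
        fix y assume "y \<in> bowen_ball f n x \<epsilon>"
        then have "\<bar>birkhoff_sum f \<psi> n x - birkhoff_sum f \<psi> n y\<bar> \<le> real n * w"
          unfolding bowen_ball_def by (intro birkhoff_sum_diff_le w) auto
        then show "birkhoff_sum f \<psi> n y \<le> birkhoff_sum f \<psi> n x + real n * w" by linarith
      qed
      have "pressure_M f Z \<alpha> \<epsilon> N \<psi> \<le> pressure_Q f \<alpha> \<epsilon> (E \<times> {n}) \<psi>"
        unfolding pressure_M_def using cov by (rule INF_lower)
      also have "\<dots> = (\<Sum>x\<in>E. ennreal (exp (- \<alpha> * real n + (SUP y\<in>bowen_ball f n x \<epsilon>. birkhoff_sum f \<psi> n y))))"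
        unfolding pressure_Q_def using E(1) by (simp add: sum.cartesian_product[symmetric])
      also have "\<dots> = ennreal (\<Sum>x\<in>E. exp (- \<alpha> * real n + (SUP y\<in>bowen_ball f n x \<epsilon>. birkhoff_sum f \<psi> n y)))"
        by (rule sum_ennreal) simp
      also have "\<dots> \<le> ennreal (\<Sum>x\<in>E. exp (real n * (w - \<alpha>)) * exp (birkhoff_sum f \<psi> n x))"
        using sup by (intro ennreal_leI sum_mono) (simp add: exp_add[symmetric] algebra_simps)
      also have "\<dots> = ennreal (exp (real n * (w - \<alpha>)) * (\<Sum>x\<in>E. exp (birkhoff_sum f \<psi> n x)))"
        by (simp add: sum_distrib_left)
      also have "\<dots> \<le> ennreal (exp (real n * (w - \<alpha>)) * exp (real n * \<beta>))"
        using sum_le_classic_partition[OF _ E(1,2)] Z \<open>\<epsilon> > 0\<close> by (intro ennreal_leI mult_left_mono) auto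
      also have "\<dots> = ennreal (exp (real n * (\<beta> + w - \<alpha>)))"
        by (simp add: exp_add[symmetric] algebra_simps)
      finally show ?thesis .
    qed
    have lim0: "(\<lambda>n. ennreal (exp (real n * (\<beta> + w - \<alpha>)))) \<longlonglongrightarrow> 0"
    proof -
      have "exp (\<beta> + w - \<alpha>) < 1" using \<beta>(2) by simp
      then have "(\<lambda>n. exp (\<beta> + w - \<alpha>) ^ n) \<longlonglongrightarrow> 0" by (intro LIMSEQ_power_zero) auto
      then have "(\<lambda>n. exp (real n * (\<beta> + w - \<alpha>))) \<longlonglongrightarrow> 0" by (simp add: exp_of_nat_mult)
      then show ?thesis using tendsto_ennrealI by fastforce
    qed
    have "pressure_M f Z \<alpha> \<epsilon> N \<psi> = 0" for N
    proof -
      have "pressure_M f Z \<alpha> \<epsilon> N \<psi> \<le> 0"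
        by (rule LIMSEQ_le_const[OF lim0]) (use M_le in \<open>auto intro!: exI[of _ "max (Suc N0) N"]\<close>)
      then show ?thesis by simp
    qed
    then have "pressure_m f Z \<alpha> \<epsilon> \<psi> = 0" unfolding pressure_m_def by (simp add: limI)
    then show ?thesis unfolding pressure_at_scale_def by (intro INF_lower) auto
  qed
  then show "pressure_at_scale f Z \<psi> \<epsilon> \<le> a"
    using a by (cases a) auto
qed

end

section \<open>Shadowing and the lower bound\<close>

text \<open>Blocks of \<open>n\<close> steps start at the multiples of \<open>L\<close>; when
  \<open>n\<close> is at most \<open>L\<close>, the remaining steps of each period are
  unconstrained. The inequality is non-strict so that the condition is closed and survives
  compactness arguments.\<close>

definition shadows :: "('a::metric_space \<Rightarrow> 'a) \<Rightarrow> nat \<Rightarrow> nat \<Rightarrow> real \<Rightarrow> (nat \<Rightarrow> 'a) \<Rightarrow> 'a \<Rightarrow> bool" where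
  "shadows f n L \<epsilon> v x \<longleftrightarrow> (\<forall>j. \<forall>p<n. dist ((f ^^ (j * L + p)) x) ((f ^^ p) (v j)) \<le> \<epsilon>)"

lemma closed_shadow_block:
  fixes f :: "'a::metric_space \<Rightarrow> 'a"
  assumes "continuous_on UNIV f"
  shows "closed {x. \<forall>p<n. dist ((f ^^ (a + p)) x) ((f ^^ p) s) \<le> \<epsilon>}"
proof -
  have "{x. \<forall>p<n. dist ((f ^^ (a + p)) x) ((f ^^ p) s) \<le> \<epsilon>}
      = (\<Inter>p\<in>{..<n}. {x. dist ((f ^^ (a + p)) x) ((f ^^ p) s) \<le> \<epsilon>})" by auto
  moreover have "closed {x. dist ((f ^^ (a + p)) x) ((f ^^ p) s) \<le> \<epsilon>}" for p
    by (intro closed_Collect_le continuous_on_dist continuous_on_const continuous_on_funpow[OF assms])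
  ultimately show ?thesis by auto
qed

text \<open>Specification treats finitely many blocks only. The block conditions are closed and have
  the finite intersection property, so compactness gives a point for an infinite sequence of blocks.
  The gap \<open>m\<close> depends on \<epsilon> but not on \<open>n\<close>, which allows
  \<open>n\<close> to be chosen afterwards.\<close>

lemma specification_imp_shadows:
  fixes f :: "'a::metric_space \<Rightarrow> 'a"
  assumes comp: "compact (UNIV :: 'a set)" and cont: "continuous_on UNIV f"
    and spec: "specification_property f" and "\<epsilon> > 0"
  obtains m where "\<And>n v. n > 0 \<Longrightarrow> \<exists>x. shadows f n (n + m) \<epsilon> v x"
proof -
  obtain mi :: int where mi: "\<And>(k::nat) (a::nat \<Rightarrow> nat) (b::nat \<Rightarrow> nat) (xs::nat \<Rightarrow> 'a).
      (\<forall>j\<in>{1..k}. a j \<le> b j) \<Longrightarrow> (\<forall>j\<in>{1..<k}. int (a (j + 1)) - int (b j) \<ge> mi) \<Longrightarrow>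
      (\<exists>x. \<forall>j\<in>{1..k}. \<forall>p\<le>b j - a j. dist ((f ^^ (p + a j)) x) ((f ^^ p) (xs j)) < \<epsilon>)"
    using spec[unfolded specification_property_def, rule_format, OF \<open>\<epsilon> > 0\<close>] by blast
  \<comment> \<open>The integer gap may be negative; \<open>nat\<close> then replaces it by 0, a
    stronger separation of the blocks.\<close>
  define m where "m = nat mi"
  show thesis
  proof (rule that[of m])
    fix n :: nat and v :: "nat \<Rightarrow> 'a" assume n: "n > 0"
    define D where "D j = {x. \<forall>p<n. dist ((f ^^ (j * (n + m) + p)) x) ((f ^^ p) (v j)) \<le> \<epsilon>}" for j
    have D_closed: "closed (D j)" for j unfolding D_def by (rule closed_shadow_block[OF cont])
    have fin: "\<exists>x. \<forall>j<J. x \<in> D j" for J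
    proof -
      \<comment> \<open>Specification numbers its intervals from 1 and \<open>shadows\<close>
        numbers its blocks from 0, hence the shift by one. Since \<open>b j\<close> is the last
        index inside a block, consecutive blocks are \<open>m\<close> + 1 apart in the sense of
        specification.\<close>
      define a where "a j = (j - 1) * (n + m)" for j
      define b where "b j = a j + (n - 1)" for j
      have "\<exists>x. \<forall>j\<in>{1..J}. \<forall>p\<le>b j - a j. dist ((f ^^ (p + a j)) x) ((f ^^ p) (v (j - 1))) < \<epsilon>"
      proof (rule mi)
        show "\<forall>j\<in>{1..J}. a j \<le> b j" by (simp add: b_def)
        show "\<forall>j\<in>{1..<J}. int (a (j + 1)) - int (b j) \<ge> mi"
        proof
          fix j assume "j \<in> {1..<J}"
          then obtain i where i: "j = Suc i" by (cases j) auto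
          have "int (a (j + 1)) - int (b j) = int m + 1"
            using n unfolding a_def b_def i by (simp add: of_nat_diff algebra_simps)
          then show "int (a (j + 1)) - int (b j) \<ge> mi" by (simp add: m_def)
        qed
      qed
      then obtain x where x: "\<And>j p. j \<in> {1..J} \<Longrightarrow> p \<le> b j - a j \<Longrightarrow>
          dist ((f ^^ (p + a j)) x) ((f ^^ p) (v (j - 1))) < \<epsilon>" by blast
      have "x \<in> D j" if "j < J" for j
        unfolding D_def
      proof (intro CollectI allI impI)
        fix p assume "p < n"
        then have "dist ((f ^^ (p + a (Suc j))) x) ((f ^^ p) (v (Suc j - 1))) < \<epsilon>"
          using that by (intro x) (auto simp: b_def)
        then show "dist ((f ^^ (j * (n + m) + p)) x) ((f ^^ p) (v j)) \<le> \<epsilon>"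
          by (simp add: a_def add.commute less_imp_le)
      qed
      then show ?thesis by blast
    qed
    have "UNIV \<inter> \<Inter>(range D) \<noteq> {}"
    proof (rule compact_imp_fip[OF comp])
      show "closed T" if "T \<in> range D" for T using that D_closed by blast
      fix F' assume F': "finite F'" "F' \<subseteq> range D"
      then obtain C where C: "finite C" "F' = D ` C" using finite_subset_image[OF F'] by blast
      obtain J where J: "\<forall>i\<in>C. i < J" using C(1) by (auto simp: finite_nat_set_iff_bounded)
      obtain x where x: "\<forall>j<J. x \<in> D j" using fin by blast
      have "x \<in> \<Inter>F'" unfolding C(2) using J x by blast
      then show "UNIV \<inter> \<Inter>F' \<noteq> {}" by blast
    qed
    then obtain x where "\<And>j. x \<in> D j" by blast
    then have "shadows f n (n + m) \<epsilon> v x" unfolding shadows_def D_def by blast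
    then show "\<exists>x. shadows f n (n + m) \<epsilon> v x" ..
  qed
qed

text \<open>In each period the shadowed block contributes an error of at most \<open>n\<close> times
  \<open>w\<close>, and the gap of \<open>m\<close> uncontrolled steps at most \<open>m\<close>
  times \<open>B\<close>.\<close>

lemma birkhoff_sum_shadows:
  assumes sh: "shadows f n (n + m) \<epsilon> v x"
    and w: "\<And>x y. dist x y \<le> \<epsilon> \<Longrightarrow> \<bar>\<psi> x - \<psi> y\<bar> \<le> w" and B: "\<And>x. \<bar>\<psi> x\<bar> \<le> B"
  shows "\<bar>birkhoff_sum f \<psi> (k * (n + m)) x - (\<Sum>j<k. birkhoff_sum f \<psi> n (v j))\<bar> \<le> real k * (real n * w + real m * B)"
proof (induction k)
  case (Suc k)
  define y where "y = (f ^^ (k * (n + m))) x"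
  have eq: "birkhoff_sum f \<psi> (Suc k * (n + m)) x
      = birkhoff_sum f \<psi> (k * (n + m)) x + birkhoff_sum f \<psi> n y + birkhoff_sum f \<psi> m ((f ^^ n) y)"
    using birkhoff_sum_add[of f \<psi> "k * (n + m)" "n + m" x] birkhoff_sum_add[of f \<psi> n m y]
    by (simp add: y_def add.commute)
  have "\<bar>birkhoff_sum f \<psi> n y - birkhoff_sum f \<psi> n (v k)\<bar> \<le> real n * w"
  proof (rule birkhoff_sum_diff_le, rule w)
    fix i assume "i < n"
    then have "dist ((f ^^ (k * (n + m) + i)) x) ((f ^^ i) (v k)) \<le> \<epsilon>" using sh unfolding shadows_def by blast
    moreover have "(f ^^ (k * (n + m) + i)) x = (f ^^ i) y"
      unfolding y_def by (subst add.commute) (simp only: funpow_add o_def)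
    ultimately show "dist ((f ^^ i) y) ((f ^^ i) (v k)) \<le> \<epsilon>" by simp
  qed
  moreover have "\<bar>birkhoff_sum f \<psi> m ((f ^^ n) y)\<bar> \<le> real m * B" by (rule birkhoff_sum_abs_le[OF B])
  ultimately have "\<bar>birkhoff_sum f \<psi> (Suc k * (n + m)) x - (\<Sum>j<Suc k. birkhoff_sum f \<psi> n (v j))\<bar>
      \<le> real k * (real n * w + real m * B) + (real n * w + real m * B)"
    using Suc.IH unfolding eq sum.lessThan_Suc by linarith
  then show ?case by (simp add: algebra_simps)
qed (simp add: birkhoff_sum_def)

section \<open>Mass distribution bound for the pressure at one scale\<close>

lemma pressure_M_le_pressure_m: "pressure_M f Z \<alpha> \<epsilon> N \<psi> \<le> pressure_m f Z \<alpha> \<epsilon> \<psi>"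
proof -
  \<comment> \<open>Raising \<open>N\<close> leaves fewer admissible covers, so the infimum grows
    and the limit is a supremum.\<close>
  have "incseq (\<lambda>N. pressure_M f Z \<alpha> \<epsilon> N \<psi>)"
  proof (rule incseq_SucI)
    fix N
    show "pressure_M f Z \<alpha> \<epsilon> N \<psi> \<le> pressure_M f Z \<alpha> \<epsilon> (Suc N) \<psi>"
      unfolding pressure_M_def by (rule INF_superset_mono) (auto simp: pressure_covers_def)
  qed
  then have "(\<lambda>N. pressure_M f Z \<alpha> \<epsilon> N \<psi>) \<longlonglongrightarrow> (SUP N. pressure_M f Z \<alpha> \<epsilon> N \<psi>)" by (rule LIMSEQ_SUP)
  then have "pressure_m f Z \<alpha> \<epsilon> \<psi> = (SUP N. pressure_M f Z \<alpha> \<epsilon> N \<psi>)" unfolding pressure_m_def by (rule limI)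
  then show ?thesis by (metis SUP_upper UNIV_I)
qed

text \<open>The blocks are chosen independently at different positions, so the set is an
  intersection over positions of finite unions of closed sets.\<close>

lemma compact_shadowing_set:
  fixes f :: "'a::metric_space \<Rightarrow> 'a"
  assumes comp: "compact (UNIV :: 'a set)" and cont: "continuous_on UNIV f" and fin: "\<And>j. finite (S j)"
  shows "compact {x. \<exists>v. (\<forall>j. v j \<in> S j) \<and> shadows f n L \<epsilon> v x}"
proof -
  define C where "C j s = {x. \<forall>p<n. dist ((f ^^ (j * L + p)) x) ((f ^^ p) s) \<le> \<epsilon>}" for j s
  have "{x. \<exists>v. (\<forall>j. v j \<in> S j) \<and> shadows f n L \<epsilon> v x} = (\<Inter>j. \<Union>s\<in>S j. C j s)"
  proof (intro set_eqI iffI)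
    fix x assume "x \<in> (\<Inter>j. \<Union>s\<in>S j. C j s)"
    then have "\<forall>j. \<exists>s. s \<in> S j \<and> x \<in> C j s" by blast
    then obtain v where "\<forall>j. v j \<in> S j \<and> x \<in> C j (v j)" by metis
    then show "x \<in> {x. \<exists>v. (\<forall>j. v j \<in> S j) \<and> shadows f n L \<epsilon> v x}"
      unfolding shadows_def C_def by blast
  qed (auto simp: shadows_def C_def)
  moreover have "closed (\<Union>s\<in>S j. C j s)" for j
    unfolding C_def using fin closed_shadow_block[OF cont] by (intro closed_UN) blast+
  ultimately have "closed {x. \<exists>v. (\<forall>j. v j \<in> S j) \<and> shadows f n L \<epsilon> v x}" by auto
  then show ?thesis using compact_Int_closed[OF comp] by fastforce
qed

text \<open>The weights \<open>p j\<close> define a product probability on words of length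
  \<open>J\<close>. The words in \<open>V\<close> lie in the cylinder that fixes the first
  \<open>k\<close> letters, and the remaining coordinates of that cylinder sum to 1.\<close>

lemma sum_prod_prefix_le:
  fixes p :: "nat \<Rightarrow> 'a \<Rightarrow> real"
  assumes "k \<le> J" and fin: "\<And>j. finite (S j)" and pos: "\<And>j s. p j s \<ge> 0"
    and one: "\<And>j. (\<Sum>s\<in>S j. p j s) = 1"
    and V: "V \<subseteq> PiE {..<J} S" "\<And>v j. v \<in> V \<Longrightarrow> j < k \<Longrightarrow> v j = u j"
  shows "(\<Sum>v\<in>V. \<Prod>j<J. p j (v j)) \<le> (\<Prod>j<k. p j (u j))"
proof -
  define S' where "S' j = (if j < k then {u j} else S j)" for j
  have fin': "finite (S' j)" for j using fin by (simp add: S'_def)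
  have "V \<subseteq> PiE {..<J} S'"
  proof
    fix v assume v: "v \<in> V"
    then have "v \<in> PiE {..<J} S" using V(1) by blast
    then show "v \<in> PiE {..<J} S'" using V(2)[OF v] by (auto simp: S'_def PiE_iff)
  qed
  then have "(\<Sum>v\<in>V. \<Prod>j<J. p j (v j)) \<le> (\<Sum>v\<in>PiE {..<J} S'. \<Prod>j<J. p j (v j))"
    using fin' pos by (intro sum_mono2 finite_PiE prod_nonneg) auto
  also have "\<dots> = (\<Prod>j<J. \<Sum>s\<in>S' j. p j s)"
    using fin' by (intro prod_sum_PiE[symmetric]) auto
  also have "\<dots> = (\<Prod>j<J. if j < k then p j (u j) else 1)"
    by (intro prod.cong) (auto simp: S'_def one)
  also have "\<dots> = (\<Prod>j<k. p j (u j))"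
    using \<open>k \<le> J\<close> by (subst prod.If_cases) (auto intro!: prod.cong)
  finally show ?thesis .
qed

lemma sum_le_pressure_Q:
  assumes "finite \<Gamma>'" "\<Gamma>' \<subseteq> \<Gamma>"
  shows "ennreal (\<Sum>(x, n)\<in>\<Gamma>'. exp (- \<alpha> * real n + (SUP y\<in>bowen_ball f n x \<epsilon>. birkhoff_sum f \<psi> n y)))
    \<le> pressure_Q f \<alpha> \<epsilon> \<Gamma> \<psi>"
proof -
  let ?t = "\<lambda>(x, n). ennreal (exp (- \<alpha> * real n + (SUP y\<in>bowen_ball f n x \<epsilon>. birkhoff_sum f \<psi> n y)))"
  have "ennreal (\<Sum>(x, n)\<in>\<Gamma>'. exp (- \<alpha> * real n + (SUP y\<in>bowen_ball f n x \<epsilon>. birkhoff_sum f \<psi> n y)))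
      = sum ?t \<Gamma>'"
    unfolding case_prod_unfold by (rule sum_ennreal[symmetric]) simp
  also have "\<dots> = infsum ?t \<Gamma>'" using assms(1) by simp
  also have "\<dots> \<le> infsum ?t \<Gamma>"
    by (rule infsum_mono_neutral) (use assms(2) in \<open>auto intro!: nonneg_summable_on_complete\<close>)
  finally show ?thesis unfolding pressure_Q_def .
qed

text \<open>Two points of one Bowen ball stay less than 2\<epsilon> apart, and each stays within
  \<epsilon> of its block. The blocks are thus less than 4\<epsilon> apart, so separation makes them
  equal. Block \<open>j\<close> must end within the first \<open>N\<close> steps.\<close>

lemma separated_shadows_same_ball:
  assumes sh: "shadows f n L \<epsilon> v y" "shadows f n L \<epsilon> v' y'"
    and ball: "y \<in> bowen_ball f N x \<epsilon>" "y' \<in> bowen_ball f N x \<epsilon>"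
    and sep: "separated_set f n (4 * \<epsilon>) S" "v j \<in> S" "v' j \<in> S" and L: "n \<le> L" "Suc j * L \<le> N"
  shows "v j = v' j"
proof (rule ccontr)
  assume "v j \<noteq> v' j"
  then obtain p where p: "p < n" "dist ((f ^^ p) (v j)) ((f ^^ p) (v' j)) > 4 * \<epsilon>"
    using sep unfolding separated_set_def by blast
  define i where "i = j * L + p"
  have "i < N" using p(1) L by (simp add: i_def)
  then have "dist ((f ^^ i) x) ((f ^^ i) y) < \<epsilon>" "dist ((f ^^ i) x) ((f ^^ i) y') < \<epsilon>"
    using ball unfolding bowen_ball_def by auto
  moreover have "dist ((f ^^ i) y) ((f ^^ p) (v j)) \<le> \<epsilon>" "dist ((f ^^ i) y') ((f ^^ p) (v' j)) \<le> \<epsilon>"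
    using sh p(1) unfolding shadows_def i_def by auto
  moreover have "dist ((f ^^ p) (v j)) ((f ^^ p) (v' j))
      \<le> dist ((f ^^ i) y) ((f ^^ p) (v j)) + dist ((f ^^ i) y) ((f ^^ p) (v' j))" by (rule dist_triangle3)
  moreover have "dist ((f ^^ i) y) ((f ^^ p) (v' j)) \<le> dist ((f ^^ i) y) ((f ^^ i) y') + dist ((f ^^ i) y') ((f ^^ p) (v' j))"
    by (rule dist_triangle)
  moreover have "dist ((f ^^ i) y) ((f ^^ i) y') \<le> dist ((f ^^ i) x) ((f ^^ i) y) + dist ((f ^^ i) x) ((f ^^ i) y')"
    by (rule dist_triangle3)
  ultimately show False using p(2) by linarith
qed

text \<open>A mass distribution argument. Words carry a product probability, and the words assigned
  to one Bowen ball have mass at most a constant times the term of that ball in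
  \<open>pressure_Q\<close>. The total mass 1 then keeps every cover sum away from 0. The
  \<open>growth\<close> hypothesis asks that the block weights pay for the rate \<open>R\<close> and
  for the shadowing and gap errors, up to a constant.\<close>

lemma pressure_at_scale_ge:
  fixes f :: "'a::metric_space \<Rightarrow> 'a" and \<psi> :: "'a \<Rightarrow> real" and S :: "nat \<Rightarrow> 'a set"
  assumes comp: "compact (UNIV :: 'a set)" and cont: "continuous_on UNIV f" and cont_\<psi>: "continuous_on UNIV \<psi>"
    and "\<epsilon> > 0" "n > 0"
    and w: "\<And>x y. dist x y \<le> \<epsilon> \<Longrightarrow> \<bar>\<psi> x - \<psi> y\<bar> \<le> w" and B: "\<And>x. \<bar>\<psi> x\<bar> \<le> B"
    and S: "\<And>j. finite (S j)" "\<And>j. S j \<noteq> {}" "\<And>j. separated_set f n (4 * \<epsilon>) (S j)"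
    and ex: "\<And>v. (\<And>j. v j \<in> S j) \<Longrightarrow> \<exists>x. shadows f n (n + m) \<epsilon> v x"
    and Z: "\<And>v x. (\<And>j. v j \<in> S j) \<Longrightarrow> shadows f n (n + m) \<epsilon> v x \<Longrightarrow> x \<in> Z"
    and growth: "\<And>k. (\<Sum>j<k. ln (\<Sum>s\<in>S j. exp (birkhoff_sum f \<psi> n s)))
      \<ge> real k * (real (n + m) * R + real n * w + real m * B) - c"
  shows "ereal R \<le> pressure_at_scale f Z \<psi> \<epsilon>"
proof -
  define L where "L = n + m"
  have L: "L > 0" "n \<le> L" using \<open>n > 0\<close> by (simp_all add: L_def)
  define K where "K = {x. \<exists>v. (\<forall>j. v j \<in> S j) \<and> shadows f n L \<epsilon> v x}"
  have K_comp: "compact K" unfolding K_def by (rule compact_shadowing_set[OF comp cont S(1)])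
  have K_Z: "K \<subseteq> Z" using Z unfolding K_def L_def by blast
  have B0: "B \<ge> 0" using B abs_ge_zero order_trans by blast
  define z where "z j = (\<Sum>s\<in>S j. exp (birkhoff_sum f \<psi> n s))" for j
  have z_pos: "z j > 0" for j unfolding z_def using S by (intro sum_pos) auto
  \<comment> \<open>Normalising the exponential weights turns each \<open>S j\<close> into a
    probability space.\<close>
  define p where "p j s = exp (birkhoff_sum f \<psi> n s) / z j" for j s
  have p_nonneg: "p j s \<ge> 0" for j s unfolding p_def using z_pos by (simp add: less_imp_le)
  have p_sum: "(\<Sum>s\<in>S j. p j s) = 1" for j
    unfolding p_def sum_divide_distrib[symmetric] z_def[symmetric] using z_pos[of j] by simp
  \<comment> \<open>Besides \<open>c\<close>, the constant absorbs the incomplete last period of a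
    ball: its share of the rate and its Birkhoff sum. The modulus of \<open>R\<close> is taken
    because its sign is unknown.\<close>
  define C where "C = c + real L * \<bar>R\<bar> + real L * B"
  have main: "ennreal (exp (- C)) \<le> pressure_Q f \<alpha> \<epsilon> \<Gamma> \<psi>"
    if "\<alpha> < R" and \<Gamma>: "\<Gamma> \<in> pressure_covers f Z \<epsilon> 0" for \<alpha> \<Gamma>
  proof -
    define t where "t = (\<lambda>(x, N). exp (- \<alpha> * real N + (SUP y\<in>bowen_ball f N x \<epsilon>. birkhoff_sum f \<psi> N y)))"
    have cov: "K \<subseteq> (\<Union>g\<in>\<Gamma>. bowen_ball f (snd g) (fst g) \<epsilon>)"
      using K_Z \<Gamma> unfolding pressure_covers_def by (auto simp: case_prod_unfold)
    obtain \<Gamma>' where \<Gamma>': "\<Gamma>' \<subseteq> \<Gamma>" "finite \<Gamma>'" "K \<subseteq> (\<Union>g\<in>\<Gamma>'. bowen_ball f (snd g) (fst g) \<epsilon>)"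
      by (rule compactE_image[OF K_comp open_bowen_ball[OF cont] cov])
    \<comment> \<open>Words need only as many letters as the longest ball of the finite cover has
      complete periods. The inserted 0 handles an empty cover.\<close>
    define J where "J = Max (insert 0 ((\<lambda>g. snd g div L) ` \<Gamma>'))"
    have J: "snd g div L \<le> J" if "g \<in> \<Gamma>'" for g
      unfolding J_def using \<Gamma>'(2) that by (intro Max_ge) auto
    \<comment> \<open>Shadowing needs an infinite sequence, so a finite word is continued by
      arbitrary admissible letters; the balls of the cover determine no letter beyond
      \<open>J\<close>.\<close>
    define ext where "ext v j = (if j < J then v j else (SOME s. s \<in> S j))" for v :: "nat \<Rightarrow> 'a" and j
    define V where "V = PiE {..<J} S"
    have V_fin: "finite V" unfolding V_def using S(1) by (intro finite_PiE) auto
    have ext_S: "ext v j \<in> S j" if "v \<in> V" for v j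
    proof (cases "j < J")
      case True
      then show ?thesis using that by (auto simp: ext_def V_def)
    next
      case False
      then show ?thesis using S(2)[of j] some_in_eq[of "S j"] by (simp add: ext_def)
    qed
    have "\<exists>x g. shadows f n L \<epsilon> (ext v) x \<and> g \<in> \<Gamma>' \<and> x \<in> bowen_ball f (snd g) (fst g) \<epsilon>" if v: "v \<in> V" for v
    proof -
      obtain x where x: "shadows f n L \<epsilon> (ext v) x" using ex[of "ext v"] ext_S[OF v] unfolding L_def by blast
      then have "x \<in> K" unfolding K_def using ext_S[OF v] by blast
      then show ?thesis using x \<Gamma>'(3) by blast
    qed
    \<comment> \<open>Every word is assigned one shadowing point and one ball of the cover
      containing it, so the fibres of \<open>G\<close> partition the words.\<close>
    then obtain X G where XG: "\<And>v. v \<in> V \<Longrightarrow> shadows f n L \<epsilon> (ext v) (X v)"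
      "\<And>v. v \<in> V \<Longrightarrow> G v \<in> \<Gamma>'" "\<And>v. v \<in> V \<Longrightarrow> X v \<in> bowen_ball f (snd (G v)) (fst (G v)) \<epsilon>"
      by metis
    have weight: "(\<Sum>v\<in>{v\<in>V. G v = g}. \<Prod>j<J. p j (v j)) \<le> exp C * t g" if g: "g \<in> \<Gamma>'" for g
    proof (cases "{v\<in>V. G v = g} = {}")
      case True
      have "exp C * t g \<ge> 0" by (simp add: t_def case_prod_unfold)
      then show ?thesis unfolding True by simp
    next
      case False
      then obtain u where u: "u \<in> V" "G u = g" by blast
      obtain x N where xN: "g = (x, N)" by (cases g)
      define k where "k = N div L"
      define r where "r = N mod L"
      have kJ: "k \<le> J" using J[OF g] by (simp add: xN k_def)
      have N: "N = k * L + r" "r < L" using L(1) by (simp_all add: k_def r_def)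
      \<comment> \<open>Words with the same ball agree on all letters whose periods fit into its
        length, so the fibre lies in one cylinder.\<close>
      have pre: "v j = u j" if v: "v \<in> {v\<in>V. G v = g}" and "j < k" for v j
      proof -
        have "Suc j * L \<le> k * L" using \<open>j < k\<close> by (intro mult_le_mono1) simp
        then have le: "Suc j * L \<le> N" using N(1) by linarith
        have v': "v \<in> V" "G v = g" using v by auto
        have "ext v j = ext u j"
          by (rule separated_shadows_same_ball[OF XG(1)[OF v'(1)] XG(1)[OF u(1)] _ _ S(3)[of j] ext_S[OF v'(1)] ext_S[OF u(1)] L(2) le])
             (use XG(3)[OF v'(1)] XG(3)[OF u(1)] v'(2) u(2) xN in auto)
        then show ?thesis using kJ \<open>j < k\<close> by (simp add: ext_def)
      qed
      have "(\<Sum>v\<in>{v\<in>V. G v = g}. \<Prod>j<J. p j (v j)) \<le> (\<Prod>j<k. p j (u j))"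
        by (rule sum_prod_prefix_le[where p = p and u = u and S = S])
           (use kJ S(1) p_nonneg p_sum pre in \<open>auto simp: V_def\<close>)
      also have "\<dots> = exp ((\<Sum>j<k. birkhoff_sum f \<psi> n (u j)) - (\<Sum>j<k. ln (z j)))"
      proof -
        have "p j s = exp (birkhoff_sum f \<psi> n s - ln (z j))" for j s
          using z_pos[of j] by (simp add: p_def exp_diff)
        then show ?thesis by (simp add: exp_sum[symmetric] sum_subtractf)
      qed
      also have "\<dots> \<le> exp (C + (- \<alpha> * real N + (SUP y\<in>bowen_ball f N x \<epsilon>. birkhoff_sum f \<psi> N y)))"
      proof -
        have "birkhoff_sum f \<psi> N (X u) \<le> (SUP y\<in>bowen_ball f N x \<epsilon>. birkhoff_sum f \<psi> N y)"
        proof (rule cSUP_upper)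
          show "X u \<in> bowen_ball f N x \<epsilon>" using XG(3)[OF u(1)] u(2) xN by simp
          show "bdd_above (birkhoff_sum f \<psi> N ` bowen_ball f N x \<epsilon>)"
            using birkhoff_sum_abs_le[of \<psi> B f N, OF B] by (intro bdd_aboveI2[of _ _ "real N * B"]) (auto simp: abs_le_iff)
        qed
        moreover have "birkhoff_sum f \<psi> N (X u) = birkhoff_sum f \<psi> (k * L) (X u) + birkhoff_sum f \<psi> r ((f ^^ (k * L)) (X u))"
          unfolding N(1) by (rule birkhoff_sum_add)
        moreover have "\<bar>birkhoff_sum f \<psi> r ((f ^^ (k * L)) (X u))\<bar> \<le> real L * B"
        proof -
          have "real r * B \<le> real L * B" using N(2) B0 by (intro mult_right_mono) auto
          then show ?thesis using birkhoff_sum_abs_le[of \<psi> B f r "(f ^^ (k * L)) (X u)", OF B] by linarith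
        qed
        moreover have "\<bar>birkhoff_sum f \<psi> (k * L) (X u) - (\<Sum>j<k. birkhoff_sum f \<psi> n (u j))\<bar> \<le> real k * (real n * w + real m * B)"
        proof -
          have "(\<Sum>j<k. birkhoff_sum f \<psi> n (ext u j)) = (\<Sum>j<k. birkhoff_sum f \<psi> n (u j))"
            using kJ by (intro sum.cong) (auto simp: ext_def)
          then show ?thesis
            using birkhoff_sum_shadows[where \<psi> = \<psi> and k = k, OF XG(1)[OF u(1), unfolded L_def] w B] by (simp add: L_def)
        qed
        moreover have "(\<Sum>j<k. ln (z j)) \<ge> real k * (real L * R + real n * w + real m * B) - c"
          using growth[of k] unfolding z_def L_def .
        moreover have "\<alpha> * real N \<le> real k * (real L * R) + real L * \<bar>R\<bar>"
        proof -
          have "\<alpha> * real N \<le> R * real N" using \<open>\<alpha> < R\<close> by (intro mult_right_mono) auto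
          also have "\<dots> = real k * (real L * R) + R * real r" unfolding N(1) by (simp add: algebra_simps)
          also have "R * real r \<le> \<bar>R\<bar> * real L" using N(2) by (intro mult_mono) auto
          finally show ?thesis by (simp add: mult.commute)
        qed
        moreover have "real k * (real L * R + real n * w + real m * B)
            = real k * (real L * R) + real k * (real n * w + real m * B)" by (simp add: algebra_simps)
        ultimately show ?thesis unfolding C_def exp_le_cancel_iff by linarith
      qed
      also have "\<dots> = exp C * t g" by (simp add: t_def xN exp_add)
      finally show ?thesis .
    qed
    \<comment> \<open>The total mass is 1; it is now distributed over the balls of the
      cover.\<close>
    have "1 = (\<Sum>v\<in>V. \<Prod>j<J. p j (v j))"
      unfolding V_def using S(1) by (subst prod_sum_PiE[symmetric]) (auto simp: p_sum)
    also have "\<dots> = (\<Sum>g\<in>\<Gamma>'. \<Sum>v\<in>{v\<in>V. G v = g}. \<Prod>j<J. p j (v j))"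
      using XG(2) by (intro sum.group[symmetric] V_fin \<Gamma>'(2)) auto
    also have "\<dots> \<le> (\<Sum>g\<in>\<Gamma>'. exp C * t g)" by (rule sum_mono[OF weight])
    also have "\<dots> = exp C * sum t \<Gamma>'" by (simp add: sum_distrib_left)
    finally have "exp (- C) \<le> sum t \<Gamma>'" by (simp add: exp_minus divide_simps mult.commute)
    then show ?thesis
      using sum_le_pressure_Q[where \<alpha> = \<alpha> and f = f and \<epsilon> = \<epsilon> and \<psi> = \<psi>, OF \<Gamma>'(2,1)] unfolding t_def
      by (meson ennreal_leI order_trans)
  qed
  show ?thesis
    unfolding pressure_at_scale_def
  proof (rule INF_greatest)
    fix \<alpha> assume "\<alpha> \<in> {\<alpha>. pressure_m f Z \<alpha> \<epsilon> \<psi> = 0}"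
    then have m0: "pressure_m f Z \<alpha> \<epsilon> \<psi> = 0" by simp
    have "\<not> \<alpha> < R"
    proof
      assume "\<alpha> < R"
      then have "ennreal (exp (- C)) \<le> pressure_M f Z \<alpha> \<epsilon> 0 \<psi>"
        unfolding pressure_M_def by (intro INF_greatest main)
      also have "\<dots> \<le> 0" using pressure_M_le_pressure_m[where f = f and Z = Z and \<alpha> = \<alpha> and \<epsilon> = \<epsilon> and N = 0 and \<psi> = \<psi>] m0 by simp
      finally show False by (simp add: ennreal_eq_0_iff)
    qed
    then show "ereal R \<le> ereal \<alpha>" by simp
  qed
qed

section \<open>Irregularity from oscillating block frequencies\<close>

text \<open>The set \<open>A\<close> alternates between full and empty intervals, each four times as
  long as the previous one, so its initial densities oscillate between at least 3/4 and at most 1/4.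
  Stretching by \<open>q\<close> dilutes it to density at most about 1/q while keeping the relative
  oscillation.\<close>

lemma oscillating_pattern:
  fixes q :: nat
  assumes "q > 0"
  obtains F :: "nat set" where "\<And>J. real (card (F \<inter> {..<J})) \<le> real J / real q + 1"
    "\<And>N. \<exists>M\<ge>N. M > 0 \<and> real (card (F \<inter> {..<q * M})) \<ge> 3 / 4 * real M"
    "\<And>N. \<exists>M\<ge>N. M > 0 \<and> real (card (F \<inter> {..<q * M})) \<le> 1 / 4 * real M"
proof -
  define A where "A = (\<Union>s. {4 ^ (2 * s)..<(4::nat) ^ (2 * s + 1)})"
  define F where "F = (\<lambda>i. q * i) ` A"
  have inj: "inj_on (\<lambda>i. q * i) X" for X using \<open>q > 0\<close> by (auto intro: inj_onI)
  have cardF: "card (F \<inter> {..<q * M}) = card (A \<inter> {..<M})" for M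
  proof -
    have "F \<inter> {..<q * M} = (\<lambda>i. q * i) ` (A \<inter> {..<M})" unfolding F_def using \<open>q > 0\<close> by auto
    then show ?thesis by (simp add: card_image[OF inj])
  qed
  have big: "N \<le> 4 ^ (2 * N + e)" for N e :: nat
  proof -
    have "N < 2 ^ N" by (rule less_exp)
    also have "(2::nat) ^ N \<le> 4 ^ N" by (rule power_mono) auto
    also have "(4::nat) ^ N \<le> 4 ^ (2 * N + e)" by (rule power_increasing) auto
    finally show ?thesis by simp
  qed
  show thesis
  proof (rule that[of F])
    fix J
    have "F \<inter> {..<J} \<subseteq> (\<lambda>i. q * i) ` {..J div q}"
    proof
      fix j assume "j \<in> F \<inter> {..<J}"
      then obtain i where i: "j = q * i" "q * i < J" by (auto simp: F_def)
      then have "i \<le> J div q" using \<open>q > 0\<close> by (simp add: less_eq_div_iff_mult_less_eq mult.commute)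
      then show "j \<in> (\<lambda>i. q * i) ` {..J div q}" using i(1) by auto
    qed
    then have "card (F \<inter> {..<J}) \<le> card ((\<lambda>i. q * i) ` {..J div q})" by (intro card_mono) auto
    also have "\<dots> = J div q + 1" by (simp add: card_image[OF inj])
    finally have "real (card (F \<inter> {..<J})) \<le> real (J div q) + 1" by linarith
    also have "real (J div q) \<le> real J / real q" by (rule of_nat_div_le_of_nat)
    finally show "real (card (F \<inter> {..<J})) \<le> real J / real q + 1" by simp
  next
    fix N :: nat
    define M where "M = (4::nat) ^ (2 * N + 1)"
    \<comment> \<open>The last full interval alone occupies three quarters of the numbers below
      \<open>M\<close>.\<close>
    have "{4 ^ (2 * N)..<M} \<subseteq> A \<inter> {..<M}" unfolding A_def M_def by auto
    then have "card {4 ^ (2 * N)..<M} \<le> card (A \<inter> {..<M})" by (intro card_mono) auto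
    then have "real (3 * 4 ^ (2 * N)) \<le> real (card (A \<inter> {..<M}))" unfolding of_nat_le_iff by (simp add: M_def)
    then have "3 / 4 * real M \<le> real (card (A \<inter> {..<M}))" by (simp add: M_def)
    moreover have "M \<ge> N" unfolding M_def by (rule big)
    moreover have "M > 0" by (simp add: M_def)
    ultimately show "\<exists>M\<ge>N. M > 0 \<and> real (card (F \<inter> {..<q * M})) \<ge> 3 / 4 * real M"
      unfolding cardF by blast
  next
    fix N :: nat
    define M where "M = (4::nat) ^ (2 * N + 2)"
    \<comment> \<open>Here \<open>M\<close> ends an empty interval, so all elements of
      \<open>A\<close> below it lie in the first quarter.\<close>
    have "A \<inter> {..<M} \<subseteq> {..<4 ^ (2 * N + 1)}"
    proof
      fix i assume "i \<in> A \<inter> {..<M}"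
      then obtain s where s: "4 ^ (2 * s) \<le> i" "i < 4 ^ (2 * s + 1)" "i < M" by (auto simp: A_def)
      then have "(4::nat) ^ (2 * s) < 4 ^ (2 * N + 2)" unfolding M_def by linarith
      then have "s \<le> N" by (simp add: power_strict_increasing_iff del: power_Suc)
      then have "(4::nat) ^ (2 * s + 1) \<le> 4 ^ (2 * N + 1)" by (intro power_increasing) auto
      then have "i < 4 ^ (2 * N + 1)" by (rule less_le_trans[OF s(2)])
      then show "i \<in> {..<4 ^ (2 * N + 1)}" by (rule lessThan_iff[THEN iffD2])
    qed
    then have "card (A \<inter> {..<M}) \<le> card {..<(4::nat) ^ (2 * N + 1)}" by (intro card_mono) auto
    then have "real (card (A \<inter> {..<M})) \<le> real (4 ^ (2 * N + 1))" unfolding of_nat_le_iff by simp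
    then have "real (card (A \<inter> {..<M})) \<le> 1 / 4 * real M" by (simp add: M_def)
    moreover have "M \<ge> N" unfolding M_def by (rule big)
    moreover have "M > 0" by (simp add: M_def)
    ultimately show "\<exists>M\<ge>N. M > 0 \<and> real (card (F \<inter> {..<q * M})) \<le> 1 / 4 * real M"
      unfolding cardF by blast
  qed
qed

text \<open>At the ends of periods the rescaled Birkhoff averages follow \<open>c\<close> plus the
  density of \<open>F\<close> times \<open>d - c\<close>, up to an error \<rho>. The density swings
  by at least 1/(2q) infinitely often, and \<open>small\<close> says that the resulting swing of the
  averages exceeds 2\<rho>, which rules out a limit.\<close>

lemma shadows_imp_irregular:
  fixes f :: "'a::metric_space \<Rightarrow> 'a" and \<phi> :: "'a \<Rightarrow> real"
  assumes sh: "shadows f n (n + m) \<epsilon> v x" and "n > 0" "q > 0"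
    and w: "\<And>x y. dist x y \<le> \<epsilon> \<Longrightarrow> \<bar>\<phi> x - \<phi> y\<bar> \<le> w" and B: "\<And>x. \<bar>\<phi> x\<bar> \<le> B"
    and F: "\<And>N. \<exists>M\<ge>N. M > 0 \<and> real (card (F \<inter> {..<q * M})) \<ge> 3 / 4 * real M"
      "\<And>N. \<exists>M\<ge>N. M > 0 \<and> real (card (F \<inter> {..<q * M})) \<le> 1 / 4 * real M"
    and c: "\<And>j. j \<notin> F \<Longrightarrow> \<bar>birkhoff_sum f \<phi> n (v j) - real n * c\<bar> \<le> real n * \<eta>"
    and d: "\<And>j. j \<in> F \<Longrightarrow> birkhoff_sum f \<phi> n (v j) = real n * d"
    and "\<eta> \<ge> 0" and small: "4 * real q * (\<eta> + w + real m * B / real n) < \<bar>d - c\<bar>"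
  shows "x \<in> irregular_set f \<phi>"
proof (rule ccontr)
  assume "x \<notin> irregular_set f \<phi>"
  then have "convergent (\<lambda>N. (1 / real N) * birkhoff_sum f \<phi> N x)"
    by (simp add: irregular_set_def birkhoff_sum_def)
  then obtain l where l: "(\<lambda>N. (1 / real N) * birkhoff_sum f \<phi> N x) \<longlonglongrightarrow> l" by (auto simp: convergent_def)
  define \<rho> where "\<rho> = \<eta> + w + real m * B / real n"
  \<comment> \<open>Dividing by the time spent in blocks instead of the total time only multiplies
    by the constant (n + m)/n. Convergence is preserved, and the main term becomes free of
    \<open>m\<close>.\<close>
  define a where "a = (\<lambda>J. birkhoff_sum f \<phi> (J * (n + m)) x / (real J * real n))"
  have a_lim: "a \<longlonglongrightarrow> l * (real (n + m) / real n)"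
  proof -
    have sm: "strict_mono (\<lambda>J. J * (n + m))" using \<open>n > 0\<close> by (simp add: strict_mono_def)
    have "(\<lambda>J. (1 / real (J * (n + m))) * birkhoff_sum f \<phi> (J * (n + m)) x * (real (n + m) / real n)) \<longlonglongrightarrow> l * (real (n + m) / real n)"
      using LIMSEQ_subseq_LIMSEQ[OF l sm] by (intro tendsto_mult tendsto_const) (simp add: o_def)
    moreover have "(1 / real (J * (n + m))) * birkhoff_sum f \<phi> (J * (n + m)) x * (real (n + m) / real n) = a J" for J
    proof -
      have "1 / (real J * L) * u * (L / real n) = u / (real J * real n)" if "L > 0" for L u :: real
        using that by simp
      then show ?thesis using \<open>n > 0\<close> unfolding a_def of_nat_mult by simp
    qed
    ultimately show ?thesis by simp
  qed
  define T where "T J = real (card (F \<inter> {..<J}))" for J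
  have approx: "\<bar>a J - c - T J / real J * (d - c)\<bar> \<le> \<rho>" if "J > 0" for J
  proof -
    have "\<bar>(\<Sum>j<J. birkhoff_sum f \<phi> n (v j)) - (\<Sum>j<J. real n * c + of_bool (j \<in> F) * (real n * (d - c)))\<bar>
        \<le> (\<Sum>j<J. real n * \<eta>)"
    proof -
      have "\<bar>birkhoff_sum f \<phi> n (v j) - (real n * c + of_bool (j \<in> F) * (real n * (d - c)))\<bar> \<le> real n * \<eta>" for j
        using c[of j] d[of j] \<open>\<eta> \<ge> 0\<close> by (cases "j \<in> F") (auto simp: algebra_simps)
      then show ?thesis unfolding sum_subtractf[symmetric] by (intro order_trans[OF sum_abs] sum_mono)
    qed
    moreover have "(\<Sum>j<J. real n * c + of_bool (j \<in> F) * (real n * (d - c))) = real J * real n * c + T J * (real n * (d - c))"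
    proof -
      have "(\<Sum>j<J. of_bool (j \<in> F) :: real) = T J"
        unfolding T_def by (simp add: sum.If_cases of_bool_def Int_commute)
      then show ?thesis by (simp add: sum.distrib sum_distrib_right[symmetric])
    qed
    moreover have "\<bar>birkhoff_sum f \<phi> (J * (n + m)) x - (\<Sum>j<J. birkhoff_sum f \<phi> n (v j))\<bar> \<le> real J * (real n * w + real m * B)"
      by (rule birkhoff_sum_shadows[OF sh w B])
    moreover have "real J * (real n * w + real m * B) + (\<Sum>j<J. real n * \<eta>) = real J * real n * \<rho>"
      using \<open>n > 0\<close> by (simp add: \<rho>_def field_simps)
    ultimately have 1: "\<bar>birkhoff_sum f \<phi> (J * (n + m)) x - (real J * real n * c + T J * (real n * (d - c)))\<bar> \<le> real J * real n * \<rho>"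
      by linarith
    have Jn: "real J * real n > 0" using \<open>n > 0\<close> that by simp
    have "a J - c - T J / real J * (d - c)
        = (birkhoff_sum f \<phi> (J * (n + m)) x - (real J * real n * c + T J * (real n * (d - c)))) / (real J * real n)"
      unfolding a_def using \<open>n > 0\<close> that by (simp add: field_simps)
    then have "\<bar>a J - c - T J / real J * (d - c)\<bar>
        = \<bar>birkhoff_sum f \<phi> (J * (n + m)) x - (real J * real n * c + T J * (real n * (d - c)))\<bar> / (real J * real n)"
      using Jn by (simp add: abs_divide)
    also have "\<dots> \<le> \<rho>" using 1 Jn by (simp add: divide_le_eq mult.commute)
    finally show ?thesis .
  qed
  \<comment> \<open>The excess of the guaranteed swing over the two errors \<rho>; each of the two
    averages compared may then be gap/4 away from the supposed limit.\<close>
  define gap where "gap = \<bar>d - c\<bar> / (2 * real q) - 2 * \<rho>"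
  have gap: "gap > 0" using small \<open>q > 0\<close> unfolding gap_def \<rho>_def[symmetric] by (simp add: field_simps)
  obtain N where N: "\<And>J. J \<ge> N \<Longrightarrow> \<bar>a J - l * (real (n + m) / real n)\<bar> < gap / 4"
    using LIMSEQ_D[OF a_lim, of "gap / 4"] gap by auto
  obtain M1 where M1: "M1 \<ge> N" "M1 > 0" "T (q * M1) \<ge> 3 / 4 * real M1" using F(1)[of N] unfolding T_def by blast
  obtain M2 where M2: "M2 \<ge> N" "M2 > 0" "T (q * M2) \<le> 1 / 4 * real M2" using F(2)[of N] unfolding T_def by blast
  define t1 where "t1 = T (q * M1) / real (q * M1)"
  define t2 where "t2 = T (q * M2) / real (q * M2)"
  have "t1 \<ge> 3 / (4 * real q)" unfolding t1_def using M1(2,3) \<open>q > 0\<close> by (simp add: field_simps)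
  moreover have "t2 \<le> 1 / (4 * real q)" unfolding t2_def using M2(2,3) \<open>q > 0\<close> by (simp add: field_simps)
  moreover have "3 / (4 * real q) - 1 / (4 * real q) = 1 / (2 * real q)" using \<open>q > 0\<close> by (simp add: field_simps)
  ultimately have "t1 - t2 \<ge> 1 / (2 * real q)" by linarith
  then have "1 / (2 * real q) * \<bar>d - c\<bar> \<le> (t1 - t2) * \<bar>d - c\<bar>" by (intro mult_right_mono) auto
  also have "\<dots> \<le> \<bar>(t1 - t2) * (d - c)\<bar>" by (simp add: abs_mult mult_right_mono)
  also have "\<dots> \<le> 2 * \<rho> + gap / 2"
  proof -
    have le: "M \<le> q * M" for M using \<open>q > 0\<close> by simp
    have "\<bar>a (q * M1) - l * (real (n + m) / real n)\<bar> < gap / 4" "\<bar>a (q * M2) - l * (real (n + m) / real n)\<bar> < gap / 4"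
      by (intro N; use M1(1) M2(1) le[of M1] le[of M2] in linarith)+
    moreover have "\<bar>a (q * M1) - c - t1 * (d - c)\<bar> \<le> \<rho>" "\<bar>a (q * M2) - c - t2 * (d - c)\<bar> \<le> \<rho>"
      unfolding t1_def t2_def using M1(2) M2(2) \<open>q > 0\<close> by (intro approx; simp)+
    ultimately show ?thesis by (simp only: left_diff_distrib)
  qed
  finally have "1 / (2 * real q) * \<bar>d - c\<bar> \<le> 2 * \<rho> + gap / 2" .
  moreover have "1 / (2 * real q) * \<bar>d - c\<bar> = gap + 2 * \<rho>" by (simp add: gap_def)
  ultimately show False using gap by linarith
qed

text \<open>Values are sorted into cells of width \<eta>. The number of cells depends on
  \<open>B\<close> and \<eta> but not on \<open>E\<close>, so some cell keeps a fixed fraction of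
  the weight, a loss that is negligible at exponential scale. The left end of that cell serves as
  \<open>c\<close>.\<close>

lemma pigeonhole_average:
  fixes g h :: "'a \<Rightarrow> real"
  assumes "finite E" "\<eta> > 0" "\<And>x. x \<in> E \<Longrightarrow> \<bar>g x\<bar> \<le> B" "e < (\<Sum>x\<in>E. h x)" "B \<ge> 0"
  obtains S c where "S \<subseteq> E" "\<And>x. x \<in> S \<Longrightarrow> \<bar>g x - c\<bar> \<le> \<eta>"
    "e / real (card {\<lfloor>- B / \<eta>\<rfloor>..\<lfloor>B / \<eta>\<rfloor>}) < (\<Sum>x\<in>S. h x)"
proof -
  define I where "I = {\<lfloor>- B / \<eta>\<rfloor>..\<lfloor>B / \<eta>\<rfloor>}"
  define k where "k x = \<lfloor>g x / \<eta>\<rfloor>" for x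
  have "\<lfloor>- B / \<eta>\<rfloor> \<le> \<lfloor>B / \<eta>\<rfloor>" using assms(2,5) by (intro floor_mono) (simp add: divide_right_mono)
  then have I: "card I > 0" "finite I" by (simp_all add: I_def)
  have kI: "k ` E \<subseteq> I"
  proof
    fix i assume "i \<in> k ` E"
    then obtain x where x: "x \<in> E" "i = k x" by blast
    have "- B \<le> g x" "g x \<le> B" using assms(3)[OF x(1)] by linarith+
    then have "- B / \<eta> \<le> g x / \<eta>" "g x / \<eta> \<le> B / \<eta>"
      using assms(2) by (intro divide_right_mono; simp)+
    then show "i \<in> I" unfolding I_def x(2) k_def by (auto intro: floor_mono)
  qed
  have "\<exists>i\<in>I. e / real (card I) < (\<Sum>x\<in>{x\<in>E. k x = i}. h x)"
  proof (rule ccontr)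
    assume "\<not> ?thesis"
    then have "(\<Sum>i\<in>I. \<Sum>x\<in>{x\<in>E. k x = i}. h x) \<le> (\<Sum>i\<in>I. e / real (card I))" by (intro sum_mono) (simp add: not_less)
    also have "\<dots> = e" using I(1) by simp
    finally have "(\<Sum>x\<in>E. h x) \<le> e" using sum.group[OF assms(1) I(2) kI, of h] by simp
    then show False using assms(4) by simp
  qed
  then obtain i where i: "e / real (card I) < (\<Sum>x\<in>{x\<in>E. k x = i}. h x)" by blast
  show thesis
  proof (rule that[of "{x\<in>E. k x = i}" "of_int i * \<eta>"])
    fix x assume "x \<in> {x\<in>E. k x = i}"
    then have "of_int i \<le> g x / \<eta>" "g x / \<eta> < of_int i + 1" unfolding k_def by (auto simp: floor_eq_iff)
    then have "of_int i * \<eta> \<le> g x" "g x < (of_int i + 1) * \<eta>" using assms(2) by (simp_all add: le_divide_eq divide_less_eq)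
    then show "\<bar>g x - of_int i * \<eta>\<bar> \<le> \<eta>" by (simp add: algebra_simps abs_le_iff)
  qed (use i I_def in auto)
qed

section \<open>Existence of invariant measures\<close>

text \<open>With base 3 and digits 0 and 1 there are no carries: at the first disagreement
  \<open>k\<close> the leading terms differ by (1/3)^k, while all later terms together change the
  difference by at most half of that.\<close>

lemma ternary_digits_eq:
  fixes P Q :: "nat \<Rightarrow> bool"
  assumes "\<bar>(\<Sum>i. of_bool (P i) * (1/3::real) ^ i) - (\<Sum>i. of_bool (Q i) * (1/3) ^ i)\<bar> < (1/3) ^ N / 2"
    and "i < N"
  shows "P i = Q i"
proof (rule ccontr)
  assume neq: "P i \<noteq> Q i"
  define k where "k = (LEAST i. P i \<noteq> Q i)"
  have k: "P k \<noteq> Q k" unfolding k_def by (rule LeastI) (rule neq)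
  have k_less: "P j = Q j" if "j < k" for j
    using not_less_Least that unfolding k_def by blast
  have "k \<le> i" unfolding k_def by (rule Least_le) (rule neq)
  have geo: "summable (\<lambda>i. (1/3::real) ^ i)" by (simp add: summable_geometric)
  have sm: "summable (\<lambda>i. of_bool (R i) * (1/3::real) ^ i)" for R
    by (rule summable_comparison_test[OF _ geo]) (auto intro!: exI[of _ 0])
  define a where "a i = (of_bool (P i) - of_bool (Q i)) * (1/3::real) ^ i" for i
  have a_sum: "summable a" and a_eq: "suminf a = (\<Sum>i. of_bool (P i) * (1/3::real) ^ i) - (\<Sum>i. of_bool (Q i) * (1/3) ^ i)"
    unfolding a_def left_diff_distrib using sm by (auto intro: summable_diff simp: suminf_diff)
  have a_le: "\<bar>a i\<bar> \<le> (1/3) ^ i" for i by (auto simp: a_def)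
  have "suminf a = (\<Sum>i. a (i + Suc k)) + sum a {..<Suc k}"
    by (rule suminf_split_initial_segment[OF a_sum])
  also have "sum a {..<Suc k} = a k"
    by (simp add: a_def k_less)
  finally have 1: "suminf a = (\<Sum>i. a (i + Suc k)) + a k" .
  have "\<bar>\<Sum>i. a (i + Suc k)\<bar> \<le> (\<Sum>i. (1/3) ^ (i + Suc k))"
  proof -
    have s3: "summable (\<lambda>i. (1/3::real) ^ (i + Suc k))" using geo by (rule summable_ignore_initial_segment)
    then have "summable (\<lambda>i. \<bar>a (i + Suc k)\<bar>)"
      by (rule summable_comparison_test[rotated]) (simp only: real_norm_def abs_idempotent a_le simp_thms)
    then have "\<bar>\<Sum>i. a (i + Suc k)\<bar> \<le> (\<Sum>i. \<bar>a (i + Suc k)\<bar>)" by (rule summable_rabs)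
    also have "\<dots> \<le> (\<Sum>i. (1/3) ^ (i + Suc k))"
      using \<open>summable (\<lambda>i. \<bar>a (i + Suc k)\<bar>)\<close> s3 by (rule suminf_le[OF a_le])
    finally show ?thesis .
  qed
  also have "\<dots> = (1/3) ^ Suc k * (\<Sum>i. (1/3) ^ i)"
    using suminf_mult[OF geo, of "(1/3) ^ Suc k"] by (simp add: power_add mult.commute)
  also have "\<dots> = (1/3) ^ k / 2"
    by (subst suminf_geometric) auto
  finally have 2: "\<bar>\<Sum>i. a (i + Suc k)\<bar> \<le> (1/3) ^ k / 2" .
  have "\<bar>a k\<bar> = (1/3) ^ k" using k by (auto simp: a_def)
  then have "\<bar>suminf a\<bar> \<ge> (1/3) ^ k / 2" using 1 2 by linarith
  moreover have "(1/3::real) ^ N \<le> (1/3) ^ k" using \<open>k \<le> i\<close> \<open>i < N\<close> by (intro power_decreasing) auto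
  ultimately show False using assms(1) a_eq by linarith
qed

text \<open>The code of a point lists, as ternary digits, its membership in countably many balls
  obtained from finite covers of radius 1/(k+1). The code need not be continuous, but close codes
  share their first digits and so place both points in one small ball: the inverse is uniformly
  continuous.\<close>

lemma compact_real_coding:
  assumes "compact (UNIV :: 'a::metric_space set)"
  obtains e :: "'a::metric_space \<Rightarrow> real" where "\<And>x. e x \<in> {0..2}"
    "\<And>\<epsilon>. \<epsilon> > 0 \<Longrightarrow> \<exists>\<delta>>0. \<forall>x y. \<bar>e x - e y\<bar> < \<delta> \<longrightarrow> dist x y < \<epsilon>"
proof -
  define cov :: "nat \<Rightarrow> 'a set \<Rightarrow> bool"
    where "cov k F \<longleftrightarrow> finite F \<and> (\<Union>x\<in>F. ball x (1 / real (Suc k))) = UNIV" for k F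
  have "\<exists>F. cov k F" for k
  proof -
    define r where "r = 1 / real (Suc k)"
    have "r > 0" by (simp add: r_def)
    then have "(UNIV :: 'a set) \<subseteq> (\<Union>x\<in>UNIV. ball x r)" using centre_in_ball by blast
    then obtain F where "F \<subseteq> UNIV" "finite F" "(UNIV :: 'a set) \<subseteq> (\<Union>x\<in>F. ball x r)"
      using compactE_image[OF assms, of UNIV "\<lambda>x. ball x r"] by blast
    then have "finite F \<and> (\<Union>x\<in>F. ball x r) = (UNIV :: 'a set)" by blast
    then show ?thesis unfolding r_def cov_def by blast
  qed
  then obtain F where "\<And>k. cov k (F k)" by metis
  then have F: "\<And>k. finite (F k)" "\<And>k. (\<Union>x\<in>F k. ball x (1 / real (Suc k))) = (UNIV :: 'a set)"
    by (auto simp: cov_def)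
  define P where "P = (\<Union>k. F k \<times> {k})"
  have Pne: "P \<noteq> {}"
  proof -
    have "F 0 \<noteq> {}" using F(2)[of 0] by auto
    then show ?thesis by (auto simp: P_def)
  qed
  have Pc: "countable P" unfolding P_def using F(1) by (auto intro: countable_finite)
  define z where "z = from_nat_into P"
  have z: "range z = P" unfolding z_def using Pne Pc by (rule range_from_nat_into)
  define U where "U i = ball (fst (z i)) (1 / real (Suc (snd (z i))))" for i
  define e where "e x = (\<Sum>i. of_bool (x \<in> U i) * (1/3::real) ^ i)" for x
  show thesis
  proof
    fix x
    have geo: "summable (\<lambda>i. (1/3::real) ^ i)" by (simp add: summable_geometric)
    have sm: "summable (\<lambda>i. of_bool (x \<in> U i) * (1/3::real) ^ i)"
      by (rule summable_comparison_test[OF _ geo]) (auto intro!: exI[of _ 0])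
    have "e x \<ge> 0" unfolding e_def by (intro suminf_nonneg sm) auto
    moreover have "e x \<le> (\<Sum>i. (1/3::real) ^ i)" unfolding e_def by (intro suminf_le sm geo) auto
    moreover have "(\<Sum>i. (1/3::real) ^ i) = 3/2" by (subst suminf_geometric) auto
    ultimately show "e x \<in> {0..2}" by auto
  next
    fix \<epsilon> :: real assume "\<epsilon> > 0"
    then obtain k where k: "1 / real (Suc k) < \<epsilon> / 2"
      using nat_approx_posE[of "\<epsilon> / 2"] by auto
    have sub: "F k \<times> {k} \<subseteq> z ` UNIV" unfolding z by (auto simp: P_def)
    have fin: "finite (F k \<times> {k})" using F(1) by blast
    obtain C where C: "finite C" "F k \<times> {k} = z ` C"
      using finite_subset_image[OF fin sub] by blast
    \<comment> \<open>The balls of level \<open>k\<close> occupy finitely many digit positions, all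
      below \<open>N\<close>.\<close>
    obtain N where N: "\<And>i. i \<in> C \<Longrightarrow> i < N"
      using C(1) by (auto simp: finite_nat_set_iff_bounded)
    have "dist x y < \<epsilon>" if "\<bar>e x - e y\<bar> < (1/3) ^ N / 2" for x y
    proof -
      obtain p where p: "p \<in> F k" "x \<in> ball p (1 / real (Suc k))" using F(2)[of k] by blast
      then have "(p, k) \<in> z ` C" using C(2) by blast
      then obtain i where i: "i \<in> C" "z i = (p, k)" by (metis imageE)
      then have "x \<in> U i" using p by (simp add: U_def)
      moreover have "(x \<in> U i) = (y \<in> U i)"
        using ternary_digits_eq[of "\<lambda>i. x \<in> U i" "\<lambda>i. y \<in> U i" N i] that N[OF i(1)] unfolding e_def by auto
      ultimately have "dist p y < 1 / real (Suc k)" using i by (simp add: U_def)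
      moreover have "dist p x < 1 / real (Suc k)" using p by simp
      ultimately show ?thesis using k dist_triangle3[of x y p] by linarith
    qed
    then show "\<exists>\<delta>>0. \<forall>x y. \<bar>e x - e y\<bar> < \<delta> \<longrightarrow> dist x y < \<epsilon>"
      by (intro exI[of _ "(1/3) ^ N / 2"]) auto
  qed
qed

text \<open>Indicators of nonempty closed sets are pointwise limits of the bounded continuous
  functions \<open>G A k\<close>, so dominated convergence gives agreement on closed sets, which are
  stable under intersection and generate the Borel sets. The empty set is treated apart, since
  \<open>infdist\<close> to it is 0.\<close>

lemma borel_measure_eqI_continuous:
  fixes M N :: "'a::metric_space measure"
  assumes "finite_measure M" "finite_measure N" "sets M = sets borel" "sets N = sets borel"
    and eq: "\<And>g :: 'a \<Rightarrow> real. continuous_on UNIV g \<Longrightarrow> (\<And>x. \<bar>g x\<bar> \<le> 1) \<Longrightarrow> (\<integral>x. g x \<partial>M) = (\<integral>x. g x \<partial>N)"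
  shows "M = N"
proof -
  interpret M: finite_measure M by fact
  interpret N: finite_measure N by fact
  define G where "G A k x = max 0 (1 - real k * infdist x A)" for A :: "'a set" and k x
  have G_cont: "continuous_on UNIV (G A k)" for A k
    unfolding G_def by (intro continuous_intros)
  have G_bd: "\<bar>G A k x\<bar> \<le> 1" for A k x
    unfolding G_def using infdist_nonneg[of x A] by auto
  have G_lim: "(\<lambda>k. G A k x) \<longlonglongrightarrow> indicator A x" if "closed A" "A \<noteq> {}" for A x
  proof (cases "x \<in> A")
    case True
    then show ?thesis by (simp add: G_def)
  next
    case False
    then have pos: "infdist x A > 0"
      using that by (simp add: infdist_nonneg order_less_le in_closed_iff_infdist_zero)
    have "eventually (\<lambda>k. real k * infdist x A \<ge> 1) sequentially"
    proof -
      obtain K where K: "real K > 1 / infdist x A" using reals_Archimedean2 by blast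
      have "real k * infdist x A \<ge> 1" if "k \<ge> K" for k
      proof -
        have "1 / infdist x A \<le> real k" using K that by linarith
        then show ?thesis using pos by (simp add: divide_le_eq)
      qed
      then show ?thesis by (auto simp: eventually_sequentially)
    qed
    then have "eventually (\<lambda>k. G A k x = 0) sequentially"
      by eventually_elim (simp add: G_def)
    then show ?thesis using False by (simp add: tendsto_eventually)
  qed
  have lim: "(\<lambda>k. \<integral>x. G A k x \<partial>M') \<longlonglongrightarrow> measure M' A"
    if "finite_measure M'" "sets M' = sets borel" "closed A" "A \<noteq> {}" for M' A
  proof -
    interpret finite_measure M' by fact
    have [measurable]: "G A k \<in> borel_measurable M'" for k
      using borel_measurable_continuous_onI[OF G_cont] that(2) by (simp cong: measurable_cong_sets)
    have A[measurable]: "A \<in> sets M'" using that by simp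
    have "(\<lambda>k. \<integral>x. G A k x \<partial>M') \<longlonglongrightarrow> (\<integral>x. indicator A x \<partial>M')"
      by (rule integral_dominated_convergence[where w="\<lambda>_. 1"])
         (use that G_lim G_bd in auto)
    then show ?thesis using A by simp
  qed
  show ?thesis
  proof (rule measure_eqI_generator_eq[where E="Collect closed" and \<Omega>=UNIV and A="\<lambda>_. UNIV"])
    show "Int_stable (Collect closed :: 'a set set)" by (auto simp: Int_stable_def)
    show "sets M = sigma_sets UNIV (Collect closed)" "sets N = sigma_sets UNIV (Collect closed)"
      using assms(3,4) by (simp_all add: borel_eq_closed)
    fix A :: "'a set" assume "A \<in> Collect closed"
    then show "emeasure M A = emeasure N A"
      using LIMSEQ_unique[OF lim[OF assms(1,3)], of A "measure N A"] lim[OF assms(2,4), of A]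
        eq[OF G_cont G_bd]
      by (cases "A = {}") (simp_all add: M.emeasure_eq_measure N.emeasure_eq_measure)
  qed (auto simp: M.emeasure_eq_measure)
qed

text \<open>Empirical measures of one orbit are transported to the line by the code
  \<open>e\<close>, where tightness yields a weak limit. Its image under an extension of the inverse
  code is the invariant measure.\<close>

lemma ex_invariant_measure:
  fixes f :: "'a::metric_space \<Rightarrow> 'a"
  assumes comp: "compact (UNIV :: 'a set)" and cont: "continuous_on UNIV f"
  shows "invariant_measures f \<noteq> {}"
proof -
  obtain e :: "'a \<Rightarrow> real" where e_bd: "\<And>x. e x \<in> {0..2}"
    and e_inv: "\<And>\<epsilon>. \<epsilon> > 0 \<Longrightarrow> \<exists>\<delta>>0. \<forall>x y. \<bar>e x - e y\<bar> < \<delta> \<longrightarrow> dist x y < \<epsilon>"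
    using compact_real_coding[OF comp] by metis
  define K where "K = closure (range e)"
  have K_closed: "closed K" by (simp add: K_def)
  have e_K: "e x \<in> K" for x unfolding K_def by (rule subsetD[OF closure_subset]) simp
  \<comment> \<open>A number in the closure \<open>K\<close> need not be the code of a point. It is
    assigned a limit of points whose codes tend to it, found by sequential compactness.\<close>
  define lp where "lp c p \<longleftrightarrow> (\<forall>\<epsilon>>0. \<exists>y. \<bar>e y - c\<bar> < \<epsilon> \<and> dist y p < \<epsilon>)" for c p
  have "\<exists>p. lp c p" if "c \<in> K" for c
  proof -
    have "\<exists>u. (\<forall>n. u n \<in> range e) \<and> u \<longlonglongrightarrow> c" using that by (simp add: K_def closure_sequential)
    then obtain u where u: "\<And>n. u n \<in> range e" "u \<longlonglongrightarrow> c" by blast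
    have "\<exists>v. \<forall>n. u n = e (v n)" using u(1) by (auto simp: image_iff intro!: choice)
    then obtain v where v: "\<And>n. u n = e (v n)" by blast
    obtain p r where pr: "strict_mono (r :: nat \<Rightarrow> nat)" "(v \<circ> r) \<longlonglongrightarrow> p"
      using comp[unfolded compact_eq_seq_compact_metric seq_compact_def, rule_format, of v] by auto
    have ec: "(\<lambda>n. e (v (r n))) \<longlonglongrightarrow> c"
      using LIMSEQ_subseq_LIMSEQ[OF u(2) pr(1)] v by (simp add: o_def)
    have "lp c p"
      unfolding lp_def
    proof (intro allI impI)
      fix \<epsilon> :: real assume "\<epsilon> > 0"
      then have "eventually (\<lambda>n. dist (e (v (r n))) c < \<epsilon> \<and> dist (v (r n)) p < \<epsilon>) sequentially"
        using tendstoD[OF ec] tendstoD[OF pr(2)] by (simp add: eventually_conj o_def)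
      then show "\<exists>y. \<bar>e y - c\<bar> < \<epsilon> \<and> dist y p < \<epsilon>"
        unfolding dist_real_def eventually_sequentially by blast
    qed
    then show ?thesis ..
  qed
  then obtain h where "\<And>c. c \<in> K \<Longrightarrow> lp c (h c)" by metis
  then have h: "\<exists>y. \<bar>e y - c\<bar> < \<epsilon> \<and> dist y (h c) < \<epsilon>" if "c \<in> K" "\<epsilon> > 0" for c \<epsilon>
    using that unfolding lp_def by blast
  have h_unif: "\<exists>\<delta>>0. \<forall>c\<in>K. \<forall>c'\<in>K. \<bar>c - c'\<bar> < \<delta> \<longrightarrow> dist (h c) (h c') < \<epsilon>" if "\<epsilon> > 0" for \<epsilon>
  proof -
    obtain \<delta> where \<delta>: "\<delta> > 0" "\<And>x y. \<bar>e x - e y\<bar> < \<delta> \<Longrightarrow> dist x y < \<epsilon> / 3"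
      using e_inv[of "\<epsilon> / 3"] \<open>\<epsilon> > 0\<close> by auto
    \<comment> \<open>Both arguments are approximated by codes within \<delta>/3, so those codes are
      less than \<delta> apart; the points are then compared in three steps of \<epsilon>/3.\<close>
    have "dist (h c) (h c') < \<epsilon>" if c: "c \<in> K" "c' \<in> K" "\<bar>c - c'\<bar> < \<delta> / 3" for c c'
    proof -
      have m: "min (\<delta> / 3) (\<epsilon> / 3) > 0" using \<delta>(1) \<open>\<epsilon> > 0\<close> by simp
      obtain y where y: "\<bar>e y - c\<bar> < min (\<delta> / 3) (\<epsilon> / 3)" "dist y (h c) < min (\<delta> / 3) (\<epsilon> / 3)"
        using h[OF c(1) m] by blast
      obtain y' where y': "\<bar>e y' - c'\<bar> < min (\<delta> / 3) (\<epsilon> / 3)" "dist y' (h c') < min (\<delta> / 3) (\<epsilon> / 3)"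
        using h[OF c(2) m] by blast
      have "\<bar>e y - e y'\<bar> < \<delta>" using y(1) y'(1) c(3) by linarith
      then have "dist y y' < \<epsilon> / 3" by (rule \<delta>(2))
      then show ?thesis
        using y(2) y'(2) dist_triangle3[of "h c" "h c'" y] dist_triangle[of y "h c'" y'] by linarith
    qed
    then show ?thesis using \<delta>(1) by (intro exI[of _ "\<delta> / 3"]) auto
  qed
  have h_e: "h (e x) = x" for x
  proof -
    have "dist x (h (e x)) \<le> \<epsilon>" if "\<epsilon> > 0" for \<epsilon>
    proof -
      obtain \<delta> where \<delta>: "\<delta> > 0" "\<And>x y. \<bar>e x - e y\<bar> < \<delta> \<Longrightarrow> dist x y < \<epsilon> / 2"
        using e_inv[of "\<epsilon> / 2"] \<open>\<epsilon> > 0\<close> by auto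
      obtain y where y: "\<bar>e y - e x\<bar> < min \<delta> (\<epsilon>/2)" "dist y (h (e x)) < min \<delta> (\<epsilon>/2)"
        using h[OF e_K[of x], of "min \<delta> (\<epsilon>/2)"] \<delta>(1) \<open>\<epsilon> > 0\<close> by auto
      then have "dist y x < \<epsilon> / 2" using \<delta>(2) by simp
      then show ?thesis using y(2) dist_triangle3[of x "h (e x)" y] by linarith
    qed
    then have "dist x (h (e x)) \<le> 0" by (rule field_le_epsilon[of _ 0, simplified])
    then show ?thesis by simp
  qed
  have h_cont: "continuous_on K h"
    unfolding continuous_on_iff dist_real_def using h_unif by (metis abs_minus_commute)
  \<comment> \<open>An arbitrary point, used both as the start of the orbit and as the value of
    \<open>h'\<close> off \<open>K\<close>.\<close>
  define x0 :: 'a where "x0 = undefined"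
  define h' where "h' c = (if c \<in> K then h c else x0)" for c
  have h'_meas[measurable]: "h' \<in> borel_measurable borel"
    unfolding h'_def using K_closed h_cont by (intro borel_measurable_continuous_on_if) auto
  define \<mu> where "\<mu> n = distr (measure_pmf (pmf_of_set {..<Suc n})) borel (\<lambda>i. e ((f ^^ i) x0))" for n
  have \<mu>_int: "(\<integral>c. g c \<partial>\<mu> n) = (\<Sum>i<Suc n. g (e ((f ^^ i) x0))) / real (Suc n)"
    if [measurable]: "g \<in> borel_measurable borel" for g :: "real \<Rightarrow> real" and n
    unfolding \<mu>_def by (subst integral_distr) (simp_all add: integral_pmf_of_set lessThan_empty_iff)
  have rd: "real_distribution (\<mu> n)" for n
    unfolding \<mu>_def by (rule prob_space.real_distribution_distr) (auto intro: measure_pmf.prob_space_axioms)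
  have tight: "tight \<mu>"
    unfolding tight_def
  proof (intro conjI allI impI exI)
    show "real_distribution (\<mu> n)" for n by (rule rd)
    show "-1 < (2::real)" by simp
    show "1 - \<epsilon> < measure (\<mu> n) {-1<..2}" if "\<epsilon> > 0" for n and \<epsilon> :: real
    proof -
      have "e x \<in> {-1<..2}" for x using e_bd[of x] by auto
      then have "(\<lambda>i. e ((f ^^ i) x0)) -` {-1<..2} = UNIV" by auto
      then have "measure (\<mu> n) {-1<..2} = 1"
        unfolding \<mu>_def by (subst measure_distr) (auto simp: measure_pmf.prob_space[simplified])
      then show ?thesis using that by simp
    qed
  qed
  obtain r M where r: "strict_mono (r :: nat \<Rightarrow> nat)" and M: "real_distribution M"
    and wc: "weak_conv_m (\<mu> \<circ> id \<circ> r) M"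
    using tight_imp_convergent_subsubsequence[OF tight strict_mono_id] by blast
  interpret M: real_distribution M by fact
  have conv: "(\<lambda>n. \<integral>c. g c \<partial>\<mu> (r n)) \<longlonglongrightarrow> (\<integral>c. g c \<partial>M)"
    if "continuous_on UNIV g" "\<And>c. \<bar>g c\<bar> \<le> B" for g :: "real \<Rightarrow> real" and B
    using weak_conv_imp_integral_bdd_continuous_conv[OF _ M wc, of g B] rd that
    by (auto simp: continuous_on_eq_continuous_at)
  \<comment> \<open>The limit measure lives on the closed set \<open>K\<close>: a bounded continuous
    function of the distance to \<open>K\<close> has integral 0 for every empirical measure, hence
    in the limit.\<close>
  have "AE c in M. infdist c K = 0"
  proof -
    define g where "g c = min 1 (infdist c K)" for c
    have g01: "0 \<le> g c" "\<bar>g c\<bar> \<le> 1" for c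
      unfolding g_def using infdist_nonneg[of c K] by auto
    have g: "continuous_on UNIV g" "\<And>c. 0 \<le> g c" "\<And>c. \<bar>g c\<bar> \<le> 1"
      using g01 unfolding g_def by (auto intro!: continuous_intros)
    then have g_meas[measurable]: "g \<in> borel_measurable borel" by (intro borel_measurable_continuous_onI)
    have "g (e x) = 0" for x using e_K by (simp add: g_def)
    then have "(\<integral>c. g c \<partial>\<mu> (r n)) = 0" for n by (subst \<mu>_int) auto
    then have "(\<integral>c. g c \<partial>M) = 0"
      using conv[OF g(1,3)] by (simp add: LIMSEQ_const_iff)
    moreover have "integrable M g"
      by (rule M.integrable_const_bound[of _ 1]) (use g in auto)
    ultimately have "AE c in M. g c = 0" using g(2) by (subst (asm) integral_nonneg_eq_0_iff_AE) auto
    then show ?thesis by eventually_elim (auto simp: g_def min_def split: if_splits)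
  qed
  then have AE_K: "AE c in M. c \<in> K"
    using in_closed_iff_infdist_zero[OF K_closed] K_def by auto
  define \<nu> where "\<nu> = distr M borel h'"
  have \<nu>_prob: "prob_space \<nu>" unfolding \<nu>_def by (rule M.prob_space_distr) simp
  have \<nu>_sets: "sets \<nu> = sets borel" by (simp add: \<nu>_def)
  have \<nu>_conv: "(\<lambda>n. (\<Sum>i<Suc (r n). g ((f ^^ i) x0)) / real (Suc (r n))) \<longlonglongrightarrow> (\<integral>x. g x \<partial>\<nu>)"
    if g: "continuous_on UNIV g" "\<And>x. \<bar>g x\<bar> \<le> 1" for g :: "'a \<Rightarrow> real"
  proof -
    have [measurable]: "g \<in> borel_measurable borel" using g(1) by (rule borel_measurable_continuous_onI)
    have gh: "continuous_on K (g \<circ> h)"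
      unfolding o_def by (rule continuous_on_compose2[OF g(1) h_cont]) auto
    \<comment> \<open>Weak convergence needs test functions on the whole line; Tietze extends
      \<open>g \<circ> h\<close> from \<open>K\<close>, and along codes the extension gives back
      \<open>g\<close>.\<close>
    obtain G where G: "continuous_on UNIV G" "\<And>c. c \<in> K \<Longrightarrow> G c = (g \<circ> h) c" "\<And>c. c \<in> UNIV \<Longrightarrow> norm (G c) \<le> 1"
      by (rule Tietze[OF gh, of UNIV 1]) (use K_closed g in auto)
    have [measurable]: "G \<in> borel_measurable borel" using G(1) by (rule borel_measurable_continuous_onI)
    have "G (e x) = g x" for x using G(2)[OF e_K] by (simp add: h_e)
    then have "(\<lambda>n. \<integral>c. G c \<partial>\<mu> (r n)) = (\<lambda>n. (\<Sum>i<Suc (r n). g ((f ^^ i) x0)) / real (Suc (r n)))"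
      by (subst \<mu>_int) auto
    moreover have "(\<integral>c. G c \<partial>M) = (\<integral>x. g x \<partial>\<nu>)"
    proof -
      have "(\<integral>x. g x \<partial>\<nu>) = (\<integral>c. g (h' c) \<partial>M)" unfolding \<nu>_def by (subst integral_distr) auto
      also have "\<dots> = (\<integral>c. G c \<partial>M)"
      proof (rule integral_cong_AE)
        show "AE c in M. g (h' c) = G c" using AE_K by eventually_elim (simp add: h'_def G(2))
      qed auto
      finally show ?thesis by simp
    qed
    ultimately show ?thesis using conv[OF G(1), of 1] G(3) by simp
  qed
  have [measurable]: "f \<in> borel_measurable borel" using cont by (rule borel_measurable_continuous_onI)
  interpret \<nu>: prob_space \<nu> by fact
  have f_meas: "f \<in> measurable \<nu> borel" using \<nu>_sets by (simp cong: measurable_cong_sets)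
  interpret f\<nu>: prob_space "distr \<nu> borel f" using f_meas by (rule \<nu>.prob_space_distr)
  have "distr \<nu> borel f = \<nu>"
  proof (rule borel_measure_eqI_continuous)
    fix g :: "'a \<Rightarrow> real" assume g: "continuous_on UNIV g" "\<And>x. \<bar>g x\<bar> \<le> 1"
    have "(\<integral>x. g x \<partial>distr \<nu> borel f) = (\<integral>x. (g \<circ> f) x \<partial>\<nu>)"
      using f_meas borel_measurable_continuous_onI[OF g(1)] by (simp add: integral_distr o_def)
    have gf: "continuous_on UNIV (g \<circ> f)" by (intro continuous_on_compose cont continuous_on_subset[OF g(1)]) auto
    have "(\<lambda>n. (\<Sum>i<Suc (r n). (g \<circ> f) ((f ^^ i) x0)) / real (Suc (r n))
           - (\<Sum>i<Suc (r n). g ((f ^^ i) x0)) / real (Suc (r n))) \<longlonglongrightarrow> (\<integral>x. (g \<circ> f) x \<partial>\<nu>) - (\<integral>x. g x \<partial>\<nu>)"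
      by (intro tendsto_diff \<nu>_conv gf g) (use g(2) in auto)
    moreover have "(\<lambda>n. (\<Sum>i<Suc (r n). (g \<circ> f) ((f ^^ i) x0)) / real (Suc (r n))
           - (\<Sum>i<Suc (r n). g ((f ^^ i) x0)) / real (Suc (r n))) \<longlonglongrightarrow> 0"
    \<comment> \<open>The averages of \<open>g \<circ> f\<close> and \<open>g\<close> along the
      orbit telescope, leaving only two boundary terms.\<close>
    proof (rule tendsto_rabs_zero_cancel, rule tendsto_sandwich[OF _ _ tendsto_const])
      have "\<bar>(\<Sum>i<Suc m. (g \<circ> f) ((f ^^ i) x0)) / real (Suc m) - (\<Sum>i<Suc m. g ((f ^^ i) x0)) / real (Suc m)\<bar>
          \<le> 2 / real (Suc m)" for m
      proof -
        have "(\<Sum>i<Suc m. (g \<circ> f) ((f ^^ i) x0)) - (\<Sum>i<Suc m. g ((f ^^ i) x0)) = g ((f ^^ Suc m) x0) - g x0"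
          using sum_lessThan_telescope[of "\<lambda>i. g ((f ^^ i) x0)" "Suc m"] by (simp add: sum_subtractf)
        moreover have "\<bar>g ((f ^^ Suc m) x0) - g x0\<bar> \<le> 2"
          using g(2)[of "(f ^^ Suc m) x0"] g(2)[of x0] by linarith
        ultimately show ?thesis
          by (simp add: diff_divide_distrib[symmetric] divide_right_mono)
      qed
      then show "\<forall>\<^sub>F n in sequentially. \<bar>(\<Sum>i<Suc (r n). (g \<circ> f) ((f ^^ i) x0)) / real (Suc (r n))
           - (\<Sum>i<Suc (r n). g ((f ^^ i) x0)) / real (Suc (r n))\<bar> \<le> 2 / real (Suc (r n))" by simp
      have "(\<lambda>n. 2 / real (Suc n)) \<longlonglongrightarrow> 0"
        using LIMSEQ_Suc[OF lim_const_over_n[of 2]] by simp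
      then show "(\<lambda>n. 2 / real (Suc (r n))) \<longlonglongrightarrow> 0"
        using LIMSEQ_subseq_LIMSEQ[OF _ r, of "\<lambda>n. 2 / real (Suc n)"] by (simp add: o_def)
    qed simp
    ultimately have "(\<integral>x. (g \<circ> f) x \<partial>\<nu>) - (\<integral>x. g x \<partial>\<nu>) = 0" by (rule LIMSEQ_unique)
    then show "(\<integral>x. g x \<partial>distr \<nu> borel f) = (\<integral>x. g x \<partial>\<nu>)"
      using \<open>(\<integral>x. g x \<partial>distr \<nu> borel f) = (\<integral>x. (g \<circ> f) x \<partial>\<nu>)\<close> by simp
  qed (use \<nu>_sets \<nu>.finite_measure_axioms f\<nu>.finite_measure_axioms in auto)
  then show ?thesis using \<nu>_prob \<nu>_sets unfolding invariant_measures_def by blast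
qed

section \<open>The irregular set\<close>

text \<open>By invariance the Birkhoff sum has integral \<open>n\<close> times the integral of
  \<phi>. It cannot exceed \<open>n\<close> times a larger number everywhere.\<close>

lemma invariant_measure_imp_small_birkhoff_sum:
  fixes f :: "'a::metric_space \<Rightarrow> 'a" and \<phi> :: "'a \<Rightarrow> real"
  assumes comp: "compact (UNIV :: 'a set)" and cont: "continuous_on UNIV f" and cont_\<phi>: "continuous_on UNIV \<phi>"
    and \<mu>: "\<mu> \<in> invariant_measures f" and a: "(\<integral>x. \<phi> x \<partial>\<mu>) < a"
  shows "\<exists>y. birkhoff_sum f \<phi> n y \<le> real n * a"
proof (rule ccontr)
  assume "\<not> ?thesis"
  then have gt: "real n * a < birkhoff_sum f \<phi> n y" for y by (simp add: not_le)
  then have "n > 0" using gt[of undefined] by (cases n) (auto simp: birkhoff_sum_def)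
  interpret prob_space \<mu> using \<mu> by (simp add: invariant_measures_def)
  have sets: "sets \<mu> = sets borel" and inv: "distr \<mu> borel f = \<mu>" using \<mu> by (auto simp: invariant_measures_def)
  obtain B where B: "\<And>x. \<bar>\<phi> x\<bar> \<le> B" using compact_continuous_bound[OF comp cont_\<phi>] by blast
  have meas: "g \<in> borel_measurable \<mu>" if "continuous_on UNIV g" for g :: "'a \<Rightarrow> real"
    using borel_measurable_continuous_onI[OF that] sets by (simp cong: measurable_cong_sets)
  have f_meas: "f \<in> measurable \<mu> borel"
    using borel_measurable_continuous_onI[OF cont] sets by (simp cong: measurable_cong_sets)
  have cont_i: "continuous_on UNIV (\<lambda>x. \<phi> ((f ^^ i) x))" for i
    by (rule continuous_on_compose2[OF cont_\<phi> continuous_on_funpow[OF cont]]) auto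
  have int: "integrable \<mu> (\<lambda>x. \<phi> ((f ^^ i) x))" for i
    by (rule integrable_const_bound[of _ B]) (use B meas[OF cont_i] in auto)
  have eq: "(\<integral>x. \<phi> ((f ^^ i) x) \<partial>\<mu>) = (\<integral>x. \<phi> x \<partial>\<mu>)" for i
  proof (induction i)
    case (Suc i)
    have "(\<integral>x. \<phi> ((f ^^ i) x) \<partial>\<mu>) = (\<integral>x. \<phi> ((f ^^ i) x) \<partial>distr \<mu> borel f)" by (simp add: inv)
    also have "\<dots> = (\<integral>x. \<phi> ((f ^^ i) (f x)) \<partial>\<mu>)"
      by (rule integral_distr[OF f_meas borel_measurable_continuous_onI[OF cont_i]])
    finally show ?case using Suc by (simp add: funpow_swap1)
  qed simp
  have "real n * a \<le> (\<integral>x. birkhoff_sum f \<phi> n x \<partial>\<mu>)"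
    using int gt unfolding birkhoff_sum_def by (intro integral_ge_const) (auto simp: less_imp_le)
  also have "\<dots> = real n * (\<integral>x. \<phi> x \<partial>\<mu>)"
    unfolding birkhoff_sum_def using int by (simp add: eq)
  also have "\<dots> < real n * a" using a \<open>n > 0\<close> by simp
  finally show False by simp
qed

lemma invariant_measures_gap_imp_birkhoff_gap:
  fixes f :: "'a::metric_space \<Rightarrow> 'a" and \<phi> :: "'a \<Rightarrow> real"
  assumes comp: "compact (UNIV :: 'a set)" and cont: "continuous_on UNIV f" and cont_\<phi>: "continuous_on UNIV \<phi>"
    and gap: "(INF \<mu>\<in>invariant_measures f. \<integral>x. \<phi> x \<partial>\<mu>) < (SUP \<mu>\<in>invariant_measures f. \<integral>x. \<phi> x \<partial>\<mu>)"
  obtains a b where "a < b" "\<And>n. \<exists>y. birkhoff_sum f \<phi> n y \<le> real n * a" "\<And>n. \<exists>y. birkhoff_sum f \<phi> n y \<ge> real n * b"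
proof -
  define I where "I \<mu> = (\<integral>x. \<phi> x \<partial>\<mu>)" for \<mu>
  have "\<exists>\<mu>\<in>invariant_measures f. \<exists>\<nu>\<in>invariant_measures f. I \<mu> < I \<nu>"
  proof (rule ccontr)
    assume "\<not> ?thesis"
    then have le: "I \<nu> \<le> I \<mu>" if "\<mu> \<in> invariant_measures f" "\<nu> \<in> invariant_measures f" for \<mu> \<nu>
      using that by (auto simp: not_less)
    obtain \<mu>0 where \<mu>0: "\<mu>0 \<in> invariant_measures f" using ex_invariant_measure[OF comp cont] by blast
    \<comment> \<open>If all integrals agree, their set is a singleton, by the existence of an
      invariant measure, and infimum and supremum coincide.\<close>
    have "I ` invariant_measures f = {I \<mu>0}" using \<mu>0 le by (auto intro: antisym)
    then show False using gap unfolding I_def[symmetric] by simp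
  qed
  then obtain \<mu> \<nu> where \<mu>\<nu>: "\<mu> \<in> invariant_measures f" "\<nu> \<in> invariant_measures f" "I \<mu> < I \<nu>" by blast
  \<comment> \<open>The points dividing the interval between the two integrals into thirds leave
    strict inequalities on both sides. The estimate from above is then applied to both \<phi> and
    its negative.\<close>
  define a where "a = (2 * I \<mu> + I \<nu>) / 3"
  define b where "b = (I \<mu> + 2 * I \<nu>) / 3"
  have ab: "I \<mu> < a" "a < b" "b < I \<nu>" using \<mu>\<nu>(3) unfolding a_def b_def by (simp_all add: field_simps)
  show thesis
  proof (rule that[OF ab(2)])
    fix n
    show "\<exists>y. birkhoff_sum f \<phi> n y \<le> real n * a"
      by (rule invariant_measure_imp_small_birkhoff_sum[OF comp cont cont_\<phi> \<mu>\<nu>(1)]) (use ab I_def in auto)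
    have "\<exists>y. birkhoff_sum f (\<lambda>x. - \<phi> x) n y \<le> real n * - b"
      by (rule invariant_measure_imp_small_birkhoff_sum[OF comp cont continuous_on_minus[OF cont_\<phi>] \<mu>\<nu>(2)])
         (use ab I_def in simp)
    then show "\<exists>y. birkhoff_sum f \<phi> n y \<ge> real n * b" by (simp add: birkhoff_sum_def sum_negf)
  qed
qed

section \<open>Lower bound for the irregular set\<close>

lemma classic_rate_gt_imp_separated:
  fixes f :: "'a::metric_space \<Rightarrow> 'a" and \<psi> :: "'a \<Rightarrow> real"
  assumes comp: "compact (UNIV :: 'a set)" and cont: "continuous_on UNIV f" and cont_\<psi>: "continuous_on UNIV \<psi>"
    and "\<epsilon> > 0" "ereal R < classic_rate f \<psi> \<epsilon>"
  obtains n E where "n \<ge> N" "finite E" "separated_set f n \<epsilon> E" "exp (real n * R) < (\<Sum>x\<in>E. exp (birkhoff_sum f \<psi> n x))"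
proof -
  \<comment> \<open>Starting from \<open>Suc N\<close> excludes \<open>n\<close> = 0, where the
    quotient carries no information.\<close>
  have "\<exists>n\<ge>Suc N. ereal R < ereal (ln (classic_partition f \<psi> n \<epsilon>) / real n)"
  proof (rule ccontr)
    assume "\<not> ?thesis"
    then have "eventually (\<lambda>n. ereal (ln (classic_partition f \<psi> n \<epsilon>) / real n) \<le> ereal R) sequentially"
      by (auto simp: eventually_sequentially not_less)
    then have "classic_rate f \<psi> \<epsilon> \<le> ereal R" unfolding classic_rate_def by (rule Limsup_bounded)
    then show False using assms(5) by simp
  qed
  then obtain n where n: "n \<ge> Suc N" "R < ln (classic_partition f \<psi> n \<epsilon>) / real n" by auto
  then have "real n * R < ln (classic_partition f \<psi> n \<epsilon>)" by (simp add: less_divide_eq mult.commute split: if_splits)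
  then have "exp (real n * R) < classic_partition f \<psi> n \<epsilon>"
    using classic_partition_pos[OF comp cont cont_\<psi> \<open>\<epsilon> > 0\<close>, of n] by (metis exp_less_mono exp_ln)
  then show thesis
    using less_classic_partitionD[OF comp cont cont_\<psi> \<open>\<epsilon> > 0\<close>] that n(1) by (metis Suc_leD)
qed

text \<open>The surplus \<open>g\<close> of \<open>R'\<close> over \<open>R\<close> is spent in
  quarters: one for the forced blocks, one for the modulus of \<psi>, one for the pigeonhole loss
  together with the gaps. The parameters \<open>q\<close>, \<eta>, \<open>Q\<close> and
  \<open>F\<close> come before \<epsilon>, then the gap \<open>m\<close>, and \<open>n\<close>
  last.\<close>

lemma pressure_irregular_set_ge:
  fixes f :: "'a::metric_space \<Rightarrow> 'a" and \<phi> \<psi> :: "'a \<Rightarrow> real"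
  assumes comp: "compact (UNIV :: 'a set)" and cont: "continuous_on UNIV f" and spec: "specification_property f"
    and cont_\<phi>: "continuous_on UNIV \<phi>" and cont_\<psi>: "continuous_on UNIV \<psi>"
    and "a < b" and lo: "\<And>n. \<exists>y. birkhoff_sum f \<phi> n y \<le> real n * a" and hi: "\<And>n. \<exists>y. birkhoff_sum f \<phi> n y \<ge> real n * b"
    and R: "ereal R < classic_pressure f \<psi>"
  obtains \<delta> where "\<delta> > 0" "\<And>\<epsilon>. 0 < \<epsilon> \<Longrightarrow> \<epsilon> < \<delta> \<Longrightarrow> ereal R \<le> pressure_at_scale f (irregular_set f \<phi>) \<psi> \<epsilon>"
proof -
  obtain R' where R': "R < R'" "ereal R' < classic_pressure f \<psi>"
    using ereal_dense2[OF R] by auto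
  obtain \<epsilon>0 where \<epsilon>0: "\<epsilon>0 > 0" "ereal R' < classic_rate f \<psi> \<epsilon>0"
    using R'(2) unfolding classic_pressure_eq_SUP[OF comp cont cont_\<psi>] by (auto simp: less_SUP_iff)
  define g where "g = R' - R"
  have g: "g > 0" using R'(1) by (simp add: g_def)
  define D where "D = b - a"
  have D: "D > 0" using \<open>a < b\<close> by (simp add: D_def)
  obtain B where B: "B > 0" "\<And>x. \<bar>\<psi> x\<bar> \<le> B" using compact_continuous_bound[OF comp cont_\<psi>] by blast
  obtain B' where B': "B' > 0" "\<And>x. \<bar>\<phi> x\<bar> \<le> B'" using compact_continuous_bound[OF comp cont_\<phi>] by blast
  \<comment> \<open>A forced block loses at most |R'| + \<open>B\<close> per step; at density 1/q
    this costs at most g/4.\<close>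
  obtain q :: nat where q: "real q > 4 * (\<bar>R'\<bar> + B) / g" using reals_Archimedean2 by blast
  have q0: "q > 0"
  proof -
    have "4 * (\<bar>R'\<bar> + B) / g > 0" using B(1) g by simp
    then show ?thesis using q by (metis less_trans of_nat_0_less_iff)
  qed
  have q_le: "(\<bar>R'\<bar> + B) / real q \<le> g / 4" using q q0 g by (simp add: field_simps)
  \<comment> \<open>Three errors of size \<eta> will arise, from the pigeonhole cell, the modulus of
    \<phi> and the gaps. The factor 32 makes \<open>4 * real q * (3 * \<eta>)\<close> equal to 3/8
    of \<open>D\<close>, below the distance D/2 available between \<open>d\<close> and
    \<open>c\<close>.\<close>
  define \<eta> where "\<eta> = D / (32 * real q)"
  have \<eta>: "\<eta> > 0" using D q0 by (simp add: \<eta>_def)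
  define Q where "Q = card {\<lfloor>- B' / \<eta>\<rfloor>..\<lfloor>B' / \<eta>\<rfloor>}"
  have Q: "Q > 0"
  proof -
    have "\<lfloor>- B' / \<eta>\<rfloor> \<le> \<lfloor>B' / \<eta>\<rfloor>" using B'(1) \<eta> by (intro floor_mono) (simp add: divide_right_mono)
    then show ?thesis by (simp add: Q_def)
  qed
  obtain \<delta>1 where \<delta>1: "\<delta>1 > 0" "\<And>x y. dist x y < \<delta>1 \<Longrightarrow> \<bar>\<psi> x - \<psi> y\<bar> \<le> g / 4"
    using compact_continuous_modulus[OF comp cont_\<psi>, of "g / 4"] g by auto
  obtain \<delta>2 where \<delta>2: "\<delta>2 > 0" "\<And>x y. dist x y < \<delta>2 \<Longrightarrow> \<bar>\<phi> x - \<phi> y\<bar> \<le> \<eta>"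
    using compact_continuous_modulus[OF comp cont_\<phi> \<eta>] by auto
  obtain F :: "nat set" where F: "\<And>J. real (card (F \<inter> {..<J})) \<le> real J / real q + 1"
    "\<And>N. \<exists>M\<ge>N. M > 0 \<and> real (card (F \<inter> {..<q * M})) \<ge> 3 / 4 * real M"
    "\<And>N. \<exists>M\<ge>N. M > 0 \<and> real (card (F \<inter> {..<q * M})) \<le> 1 / 4 * real M"
    using oscillating_pattern[OF q0] by blast
  show thesis
  \<comment> \<open>Distinguishing blocks requires separation 4\<epsilon>, so \<epsilon> stays below
    \<epsilon>0/4, where the rate is already large.\<close>
  proof (rule that[of "min (\<epsilon>0 / 4) (min \<delta>1 \<delta>2)"])
    show "min (\<epsilon>0 / 4) (min \<delta>1 \<delta>2) > 0" using \<epsilon>0(1) \<delta>1(1) \<delta>2(1) by simp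
    fix \<epsilon> :: real assume \<epsilon>: "0 < \<epsilon>" "\<epsilon> < min (\<epsilon>0 / 4) (min \<delta>1 \<delta>2)"
    have w: "\<bar>\<psi> x - \<psi> y\<bar> \<le> g / 4" "\<bar>\<phi> x - \<phi> y\<bar> \<le> \<eta>" if "dist x y \<le> \<epsilon>" for x y
      using that \<epsilon>(2) \<delta>1(2) \<delta>2(2) by auto
    obtain m where m: "\<And>n v. n > 0 \<Longrightarrow> \<exists>x. shadows f n (n + m) \<epsilon> v x"
      using specification_imp_shadows[OF comp cont spec \<epsilon>(1)] by blast
    obtain N :: nat where N: "real N > max ((ln (real Q) + real m * (\<bar>R\<bar> + B)) * 4 / g) (real m * B' / \<eta>)"
      using reals_Archimedean2 by blast
    have rate: "ereal R' < classic_rate f \<psi> (4 * \<epsilon>)"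
      using classic_rate_antimono[OF comp cont cont_\<psi>, of "4 * \<epsilon>" \<epsilon>0] \<epsilon> \<epsilon>0(2) by auto
    obtain n E where n: "n \<ge> Suc N" and E: "finite E" "separated_set f n (4 * \<epsilon>) E"
      "exp (real n * R') < (\<Sum>x\<in>E. exp (birkhoff_sum f \<psi> n x))"
      using classic_rate_gt_imp_separated[OF comp cont cont_\<psi> _ rate, of "Suc N"] \<epsilon>(1) by auto
    have n0: "n > 0" using n by simp
    have n1: "ln (real Q) + real m * (\<bar>R\<bar> + B) \<le> real n * (g / 4)"
    proof -
      have "(ln (real Q) + real m * (\<bar>R\<bar> + B)) * 4 / g \<le> real n" using N n by linarith
      then show ?thesis using g by (simp add: divide_le_eq)
    qed
    have n2: "real m * B' / real n \<le> \<eta>"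
    proof -
      have "real m * B' / \<eta> \<le> real n" using N n by linarith
      then show ?thesis using \<eta> n0 by (simp add: divide_le_eq mult.commute)
    qed
    have avg: "\<bar>birkhoff_sum f \<phi> n x / real n\<bar> \<le> B'" for x
      using birkhoff_sum_abs_le[of \<phi> B' f n x, OF B'(2)] n0 by (simp add: abs_divide divide_le_eq mult.commute)
    obtain S c where S: "S \<subseteq> E" "\<And>x. x \<in> S \<Longrightarrow> \<bar>birkhoff_sum f \<phi> n x / real n - c\<bar> \<le> \<eta>"
      "exp (real n * R') / real Q < (\<Sum>x\<in>S. exp (birkhoff_sum f \<psi> n x))"
      using pigeonhole_average[of E \<eta> "\<lambda>x. birkhoff_sum f \<phi> n x / real n" B', OF E(1) \<eta> avg E(3)] B'(1)
      unfolding Q_def by (metis less_imp_le)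
    have S_fin: "finite S" using S(1) E(1) by (rule finite_subset)
    have S_ne: "S \<noteq> {}"
    proof
      assume "S = {}"
      moreover have "exp (real n * R') / real Q > 0" using Q by simp
      ultimately show False using S(3) by simp
    qed
    \<comment> \<open>Averages at most \<open>a\<close> and at least \<open>b\<close> both occur,
      and \<open>c\<close> is at least half of \<open>b - a\<close> away from one of them, depending
      on its side of the midpoint.\<close>
    obtain y where y: "\<bar>birkhoff_sum f \<phi> n y / real n - c\<bar> \<ge> D / 2"
    proof -
      obtain y1 where y1: "birkhoff_sum f \<phi> n y1 \<le> real n * a" using lo by blast
      obtain y2 where y2: "birkhoff_sum f \<phi> n y2 \<ge> real n * b" using hi by blast
      define A where "A y = birkhoff_sum f \<phi> n y / real n" for y
      have 1: "A y1 \<le> a" unfolding A_def using y1 n0 by (simp add: divide_le_eq mult.commute)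
      have 2: "A y2 \<ge> b" unfolding A_def using y2 n0 by (simp add: le_divide_eq mult.commute)
      show thesis
      proof (cases "c \<ge> (a + b) / 2")
        case True
        then have "\<bar>A y1 - c\<bar> \<ge> (b - a) / 2" using 1 by argo
        then show thesis using that unfolding A_def D_def by blast
      next
        case False
        then have "\<bar>A y2 - c\<bar> \<ge> (b - a) / 2" using 2 by argo
        then show thesis using that unfolding A_def D_def by blast
      qed
    qed
    define d where "d = birkhoff_sum f \<phi> n y / real n"
    \<comment> \<open>Positions in \<open>F\<close> offer no choice and contribute no entropy; all
      others offer the whole of \<open>S\<close>.\<close>
    define blk where "blk j = (if j \<in> F then {y} else S)" for j
    have blk: "finite (blk j)" "blk j \<noteq> {}" "separated_set f n (4 * \<epsilon>) (blk j)" for j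
      using S_fin S_ne E(2) S(1) unfolding blk_def separated_set_def by auto
    show "ereal R \<le> pressure_at_scale f (irregular_set f \<phi>) \<psi> \<epsilon>"
    proof (rule pressure_at_scale_ge[OF comp cont cont_\<psi> \<epsilon>(1) n0 w(1) B(2) blk])
      show "\<exists>x. shadows f n (n + m) \<epsilon> v x" for v by (rule m[OF n0])
    next
      fix v x assume v: "\<And>j. v j \<in> blk j" and sh: "shadows f n (n + m) \<epsilon> v x"
      show "x \<in> irregular_set f \<phi>"
      proof (rule shadows_imp_irregular[OF sh n0 q0 w(2) B'(2) F(2,3)])
        fix j assume "j \<notin> F"
        then have "\<bar>birkhoff_sum f \<phi> n (v j) / real n - c\<bar> \<le> \<eta>" using v[of j] S(2) by (simp add: blk_def)
        moreover have "\<bar>birkhoff_sum f \<phi> n (v j) - real n * c\<bar> = real n * \<bar>birkhoff_sum f \<phi> n (v j) / real n - c\<bar>"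
          using n0 by (simp add: abs_mult_pos' field_simps)
        ultimately show "\<bar>birkhoff_sum f \<phi> n (v j) - real n * c\<bar> \<le> real n * \<eta>" by (simp add: mult_left_mono)
      next
        fix j assume "j \<in> F"
        then show "birkhoff_sum f \<phi> n (v j) = real n * d" using v[of j] n0 by (simp add: blk_def d_def)
      next
        show "\<eta> \<ge> 0" using \<eta> by simp
        have "4 * real q * (\<eta> + \<eta> + real m * B' / real n) \<le> 4 * real q * (3 * \<eta>)" using n2 by (intro mult_left_mono) auto
        also have "\<dots> = 3 / 8 * D" using q0 by (simp add: \<eta>_def)
        also have "\<dots> < D / 2" using D by simp
        finally show "4 * real q * (\<eta> + \<eta> + real m * B' / real n) < \<bar>d - c\<bar>" using y unfolding d_def by linarith
      qed
    next
      fix k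
      define T where "T = real (card (F \<inter> {..<k}))"
      \<comment> \<open>The guaranteed logarithmic weight of an unforced block after the pigeonhole
        loss.\<close>
      define free where "free = real n * R' - ln (real Q)"
      have lnQ: "ln (real Q) \<ge> 0" using Q by simp
      have "(\<Sum>j<k. ln (\<Sum>s\<in>blk j. exp (birkhoff_sum f \<psi> n s))) \<ge> (\<Sum>j<k. free - of_bool (j \<in> F) * (real n * (\<bar>R'\<bar> + B)))"
      proof (rule sum_mono)
        fix j
        show "free - of_bool (j \<in> F) * (real n * (\<bar>R'\<bar> + B)) \<le> ln (\<Sum>s\<in>blk j. exp (birkhoff_sum f \<psi> n s))"
        proof (cases "j \<in> F")
          case True
          have "real n * R' \<le> real n * \<bar>R'\<bar>" by (intro mult_left_mono) auto
          then have "free - real n * (\<bar>R'\<bar> + B) \<le> - (real n * B)" using lnQ by (simp add: free_def algebra_simps)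
          also have "\<dots> \<le> birkhoff_sum f \<psi> n y" using birkhoff_sum_abs_le[of \<psi> B f n y, OF B(2)] by linarith
          finally show ?thesis using True by (simp add: blk_def)
        next
          case False
          have "exp free = exp (real n * R') / real Q" using Q by (simp add: free_def exp_diff)
          then have "exp free < (\<Sum>s\<in>S. exp (birkhoff_sum f \<psi> n s))" using S(3) by simp
          then have "free < ln (\<Sum>s\<in>S. exp (birkhoff_sum f \<psi> n s))"
            by (metis exp_gt_zero less_trans ln_exp ln_less_cancel_iff)
          then show ?thesis using False by (simp add: blk_def)
        qed
      qed
      moreover have "(\<Sum>j<k. free - of_bool (j \<in> F) * (real n * (\<bar>R'\<bar> + B))) = real k * free - T * (real n * (\<bar>R'\<bar> + B))"
      proof -
        have "(\<Sum>j<k. of_bool (j \<in> F) :: real) = T"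
          unfolding T_def by (simp add: sum.If_cases of_bool_def Int_commute)
        then show ?thesis by (simp add: sum_subtractf sum_distrib_right[symmetric])
      qed
      \<comment> \<open>The additive 1 in the density bound of \<open>F\<close> becomes the constant
        allowed in the growth hypothesis.\<close>
      moreover have "T * (real n * (\<bar>R'\<bar> + B)) \<le> real k * (real n * (g / 4)) + real n * (\<bar>R'\<bar> + B)"
      proof -
        have "T * (real n * (\<bar>R'\<bar> + B)) \<le> (real k / real q + 1) * (real n * (\<bar>R'\<bar> + B))"
          using F(1)[of k] B(1) unfolding T_def by (intro mult_right_mono) auto
        also have "\<dots> = real k * (real n * ((\<bar>R'\<bar> + B) / real q)) + real n * (\<bar>R'\<bar> + B)"
          using q0 by (simp add: field_simps)
        also have "real k * (real n * ((\<bar>R'\<bar> + B) / real q)) \<le> real k * (real n * (g / 4))"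
          using q_le by (intro mult_left_mono) auto
        finally show ?thesis by simp
      qed
      moreover have "real k * (real (n + m) * R + real n * (g / 4) + real m * B) \<le> real k * (free - real n * (g / 4))"
      proof (rule mult_left_mono)
        have "real m * R \<le> real m * \<bar>R\<bar>" by (intro mult_left_mono) auto
        then have "real (n + m) * R + real m * B + ln (real Q) \<le> real n * R + real n * (g / 4)"
          using n1 by (simp add: algebra_simps)
        moreover have "real n * R' = real n * R + 4 * (real n * (g / 4))" by (simp add: g_def field_simps)
        moreover have "real n * (g / 4) \<ge> 0" using g by simp
        ultimately show "real (n + m) * R + real n * (g / 4) + real m * B \<le> free - real n * (g / 4)"
          unfolding free_def by linarith
      qed simp
      ultimately show "(\<Sum>j<k. ln (\<Sum>s\<in>blk j. exp (birkhoff_sum f \<psi> n s)))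
          \<ge> real k * (real (n + m) * R + real n * (g / 4) + real m * B) - real n * (\<bar>R'\<bar> + B)"
        by (simp add: right_diff_distrib)
    qed
  qed
qed

theorem theorem2p1:
  fixes f :: "'a::metric_space \<Rightarrow> 'a" and \<phi> :: "'a \<Rightarrow> real"
  assumes "compact (UNIV :: 'a set)"
    and "continuous_on UNIV f"
    and "specification_property f"
    and "continuous_on UNIV \<phi>"
    and "(INF \<mu>\<in>invariant_measures f. \<integral>x. \<phi> x \<partial>\<mu>) < (SUP \<mu>\<in>invariant_measures f. \<integral>x. \<phi> x \<partial>\<mu>)"
  shows "\<forall>\<psi> :: 'a \<Rightarrow> real. continuous_on UNIV \<psi> \<longrightarrow>
    pressure f (irregular_set f \<phi>) \<psi> = classic_pressure f \<psi>"
proof (intro allI impI)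
  fix \<psi> :: "'a \<Rightarrow> real" assume cont_\<psi>: "continuous_on UNIV \<psi>"
  note comp = assms(1) and cont = assms(2)
  obtain a b where ab: "a < b" "\<And>n. \<exists>y. birkhoff_sum f \<phi> n y \<le> real n * a" "\<And>n. \<exists>y. birkhoff_sum f \<phi> n y \<ge> real n * b"
    using invariant_measures_gap_imp_birkhoff_gap[OF comp cont assms(4,5)] by metis
  have "(pressure_at_scale f (irregular_set f \<phi>) \<psi> \<longlongrightarrow> classic_pressure f \<psi>) (at_right 0)"
  proof (rule order_tendstoI)
    fix l assume "l < classic_pressure f \<psi>"
    then obtain R where R: "l < ereal R" "ereal R < classic_pressure f \<psi>" using ereal_dense2 by blast
    obtain \<delta> where \<delta>: "\<delta> > 0" "\<And>\<epsilon>. 0 < \<epsilon> \<Longrightarrow> \<epsilon> < \<delta> \<Longrightarrow> ereal R \<le> pressure_at_scale f (irregular_set f \<phi>) \<psi> \<epsilon>"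
      using pressure_irregular_set_ge[OF comp cont assms(3,4) cont_\<psi> ab R(2)] by metis
    then show "eventually (\<lambda>\<epsilon>. l < pressure_at_scale f (irregular_set f \<phi>) \<psi> \<epsilon>) (at_right 0)"
      using R(1) unfolding eventually_at_right_field by (meson less_le_trans)
  next
    fix u assume u: "classic_pressure f \<psi> < u"
    \<comment> \<open>The classical pressure is treated as an extended real: a finite value leaves
      room for a small \<open>w\<close>, while for -\<infinity> any positive \<open>w\<close> will
      do.\<close>
    obtain w where w: "w > 0" "classic_pressure f \<psi> + ereal w < u"
    proof -
      obtain v where v: "classic_pressure f \<psi> < ereal v" "ereal v < u" using ereal_dense2[OF u] by blast
      show thesis
      proof (cases "classic_pressure f \<psi>")
        case (real r)
        then show thesis using v by (intro that[of "v - r"]) auto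
      next
        case MInf
        then show thesis using u by (intro that[of 1]) auto
      qed (use v in auto)
    qed
    obtain \<delta> where \<delta>: "\<delta> > 0" "\<And>x y. dist x y < \<delta> \<Longrightarrow> \<bar>\<psi> x - \<psi> y\<bar> \<le> w"
      using compact_continuous_modulus[OF comp cont_\<psi> w(1)] by blast
    have "pressure_at_scale f (irregular_set f \<phi>) \<psi> \<epsilon> < u" if "0 < \<epsilon>" "\<epsilon> < \<delta>" for \<epsilon>
    proof -
      have "pressure_at_scale f (irregular_set f \<phi>) \<psi> \<epsilon> \<le> classic_rate f \<psi> (\<epsilon> / 2) + ereal w"
        by (rule pressure_at_scale_le_classic_rate[OF comp cont cont_\<psi> that(1)]) (use \<delta>(2) that in auto)
      also have "\<dots> \<le> classic_pressure f \<psi> + ereal w"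
        unfolding classic_pressure_eq_SUP[OF comp cont cont_\<psi>] using that
        by (intro add_right_mono SUP_upper) auto
      also have "\<dots> < u" by (rule w(2))
      finally show ?thesis .
    qed
    then show "eventually (\<lambda>\<epsilon>. pressure_at_scale f (irregular_set f \<phi>) \<psi> \<epsilon> < u) (at_right 0)"
      using \<delta>(1) unfolding eventually_at_right_field by blast
  qed
  then show "pressure f (irregular_set f \<phi>) \<psi> = classic_pressure f \<psi>"
    unfolding pressure_def by (intro tendsto_Lim) auto
qed

end
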